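(* Let $\Gamma=\Gamma_1\cup\Gamma_2\subset\mathbb{R}^2$, where $\Gamma_1=\{e^{i\theta}: 0\le\theta\le 2\pi\}$ is the unit circle and $\Gamma_2=\{(r,0): r>1\}\cong[1,\infty)$. Let $a\in L_2(0,2\pi)$ and $\alpha:=\frac{1}{2\pi}\int_0^{2\pi}a(\theta)\,d\theta$. If $\alpha\notin\mathbb{Z}$, then $$h_a[u] \geq \lambda_*(\alpha) \int_\Gamma \psi\, |u|^2 \,dx \quad\text{for all } u\in H^1(\Gamma),$$ where $\psi(\theta):=1$ on $\Gamma_1$ and $\psi(r):=r^{-2}$ on $\Gamma_2$. The constant $\lambda_*(\alpha)$ is sharp.
   Context: A function $u$ on $\Gamma$ is identified with the pair $(u_1,u_2)$, where $u_1(\theta)=u(e^{i\theta})$, $\theta\in[0,2\pi]$, and $u_2(r)=u((r,0))$, $r\ge1$. $H^1(\Gamma)$ consists of continuous functions on $\Gamma$ (so $u_1(0)=u_1(2\pi)=u_2(1)$) with $u_1\in H^1(0,2\pi)$, $u_2\in H^1(1,\infty)$. The quadratic form is $$h_a[u]=\int_0^{2\pi}|-iu_1'(\theta)-a(\theta)u_1(\theta)|^2\,d\theta+\int_1^\infty|u_2'(r)|^2\,dr,$$ and $\int_\Gamma \psi|u|^2dx=\int_0^{2\pi}|u_1|^2d\theta+\int_1^\infty r^{-2}|u_2(r)|^2dr$. For $0<\alpha\le 1/2$, $\lambda_*(\alpha)$ is the unique solution $\lambda\in(0,\alpha^2)$ of $\cos(2\pi\alpha)=\cos(2\pi\sqrt\lambda)-\frac{1-\sqrt{1-4\lambda}}{4\sqrt\lambda}\sin(2\pi\sqrt\lambda)$;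 $\lambda_*$ is then extended to an even, $1$-periodic function on $\mathbb{R}$. *)

theory Defs
  imports "HOL-Analysis.Analysis"
begin

definition L2_on :: "real set \<Rightarrow> (real \<Rightarrow> 'a::euclidean_space) \<Rightarrow> bool" where
  "L2_on S f \<longleftrightarrow> f measurable_on S \<and> (\<lambda>x. (norm (f x))^2) integrable_on S"

text \<open>u is in H^1(lo,hi) with weak derivative g: u is the indefinite integral of g (absolutely
  continuous) and u, g are in L2(lo,hi).\<close>
definition H1_interval :: "real \<Rightarrow> real \<Rightarrow> (real \<Rightarrow> complex) \<Rightarrow> (real \<Rightarrow> complex) \<Rightarrow> bool" where
  "H1_interval lo hi u g \<longleftrightarrow> L2_on {lo..hi} u \<and> L2_on {lo..hi} g \<and>
     (\<forall>x\<in>{lo..hi}. (g has_integral (u x - u lo)) {lo..x})"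

definition H1_halfline :: "real \<Rightarrow> (real \<Rightarrow> complex) \<Rightarrow> (real \<Rightarrow> complex) \<Rightarrow> bool" where
  "H1_halfline lo u g \<longleftrightarrow> L2_on {lo..} u \<and> L2_on {lo..} g \<and>
     (\<forall>x\<in>{lo..}. (g has_integral (u x - u lo)) {lo..x})"

text \<open>u = (u1,u2) in H^1(Gamma), with weak derivatives g1, g2 of u1, u2 (including continuity at the junction).\<close>
definition H1_Gamma :: "(real \<Rightarrow> complex) \<Rightarrow> (real \<Rightarrow> complex) \<Rightarrow> (real \<Rightarrow> complex) \<Rightarrow> (real \<Rightarrow> complex) \<Rightarrow> bool" where
  "H1_Gamma u1 g1 u2 g2 \<longleftrightarrow> H1_interval 0 (2*pi) u1 g1 \<and> H1_halfline 1 u2 g2 \<and>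
     u1 0 = u1 (2*pi) \<and> u1 0 = u2 1"

definition h_form :: "(real \<Rightarrow> real) \<Rightarrow> (real \<Rightarrow> complex) \<Rightarrow> (real \<Rightarrow> complex) \<Rightarrow> (real \<Rightarrow> complex) \<Rightarrow> (real \<Rightarrow> complex) \<Rightarrow> real" where
  "h_form a u1 g1 u2 g2 =
     integral {0..2*pi} (\<lambda>\<theta>. (cmod (- \<i> * g1 \<theta> - complex_of_real (a \<theta>) * u1 \<theta>))^2)
     + integral {1..} (\<lambda>r. (cmod (g2 r))^2)"

definition psi_norm :: "(real \<Rightarrow> complex) \<Rightarrow> (real \<Rightarrow> complex) \<Rightarrow> real" where
  "psi_norm u1 u2 =
     integral {0..2*pi} (\<lambda>\<theta>. (cmod (u1 \<theta>))^2) + integral {1..} (\<lambda>r. (cmod (u2 r))^2 / r^2)"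

text \<open>lambda_* on (0,1/2]: the unique solution in (0, alpha^2) of the transcendental equation.\<close>
definition lambda_star_base :: "real \<Rightarrow> real" where
  "lambda_star_base \<alpha> = (THE lam. 0 < lam \<and> lam < \<alpha>^2 \<and>
      cos (2*pi*\<alpha>) = cos (2 * pi * sqrt lam) - (1 - sqrt (1 - 4*lam)) / (4 * sqrt lam) * sin (2 * pi * sqrt lam))"

text \<open>Even, 1-periodic extension (value at integers irrelevant, set to 0).\<close>
definition lambda_star :: "real \<Rightarrow> real" where
  "lambda_star \<alpha> = (let \<beta> = \<bar>\<alpha> - of_int (round \<alpha>)\<bar> in if \<beta> = 0 then 0 else lambda_star_base \<beta>)"

end

theory Submission
  imports Defs
begin

text \<open>
  The gauge factor \<open>exp (- \<i> * \<integral> a)\<close> removes \<open>a\<close> from the form at the price of the quasi-periodicity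
  \<open>v (2 * pi) = exp (- 2 * pi * \<i> * \<alpha>) * v 0\<close>. For \<open>\<lambda> = k\<^sup>2 < 1/4\<close> and a given value \<open>c\<close> at the junction,
  the infimum of \<open>\<integral> \<bar>v'\<bar>\<^sup>2 - \<lambda> * \<bar>v\<bar>\<^sup>2\<close> on the circle is
  \<open>2 * k * (cos (2 * pi * k) - cos (2 * pi * \<alpha>)) / sin (2 * pi * k) * \<bar>c\<bar>\<^sup>2\<close>, and the infimum of
  \<open>\<integral> \<bar>u'\<bar>\<^sup>2 - \<lambda> * \<bar>u\<bar>\<^sup>2 / r\<^sup>2\<close> on the half-line is \<open>- s * \<bar>c\<bar>\<^sup>2\<close> with \<open>s = (1 - sqrt (1 - 4 * \<lambda>)) / 2\<close>.
  The equation defining \<open>\<lambda>\<^sub>*\<close> says that these two values add up to zero. The infimum on the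
  half-line is approached, but not attained, by cutting off \<open>r powr s\<close>.
\<close>

section \<open>Indefinite integrals of absolutely integrable functions\<close>

text \<open>Absolute continuity in integral form: \<open>f\<close> is a density of \<open>F\<close>,
  and nothing is said about pointwise derivatives. Absolute integrability is included because it
  survives multiplication by continuous functions, as the product and chain rules require.\<close>

definition AC_on :: "real \<Rightarrow> real \<Rightarrow> (real \<Rightarrow> complex) \<Rightarrow> (real \<Rightarrow> complex) \<Rightarrow> bool" where
  "AC_on a b F f \<longleftrightarrow> a \<le> b \<and> f absolutely_integrable_on {a..b} \<and>
     (\<forall>x\<in>{a..b}. (f has_integral (F x - F a)) {a..x})"

lemma AC_on_le: "AC_on a b F f \<Longrightarrow> a \<le> b"
  and AC_on_absolutely_integrable: "AC_on a b F f \<Longrightarrow> f absolutely_integrable_on {a..b}"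
  by (auto simp: AC_on_def)

lemma AC_on_has_integral:
  assumes "AC_on a b F f" "a \<le> x" "x \<le> y" "y \<le> b"
  shows "(f has_integral (F y - F x)) {x..y}"
proof -
  have x: "(f has_integral (F x - F a)) {a..x}" and y: "(f has_integral (F y - F a)) {a..y}"
    using assms by (auto simp: AC_on_def)
  have i: "f integrable_on {x..y}"
    using y assms(2,3) integrable_subinterval_real[of f a y x y] by (auto simp: integrable_on_def)
  have "integral {a..x} f + integral {x..y} f = integral {a..y} f"
    using y assms by (intro Henstock_Kurzweil_Integration.integral_combine) (auto simp: integrable_on_def)
  then have "integral {x..y} f = F y - F x"
    using x y by (simp add: integral_unique algebra_simps)
  then show ?thesis
    using i by (metis integrable_integral)
qed

lemma AC_on_continuous:
  assumes "AC_on a b F f"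
  shows "continuous_on {a..b} F"
proof -
  have "continuous_on {a..b} (\<lambda>x. F a + integral {a..x} f)"
    using AC_on_absolutely_integrable[OF assms]
    by (intro continuous_intros indefinite_integral_continuous_1 set_lebesgue_integral_eq_integral(1))
  moreover have "F a + integral {a..x} f = F x" if "x \<in> {a..b}" for x
    using integral_unique[OF AC_on_has_integral[OF assms, of a x]] that by auto
  ultimately show ?thesis
    by (subst continuous_on_cong[OF refl, symmetric]) auto
qed

lemma AC_on_cong:
  assumes "AC_on a b F f" "\<And>x. x \<in> {a..b} \<Longrightarrow> F x = G x" "\<And>x. x \<in> {a..b} \<Longrightarrow> f x = g x"
  shows "AC_on a b G g"
proof -
  have "g absolutely_integrable_on {a..b}"
    using AC_on_absolutely_integrable[OF assms(1)] assms(3)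
    by (subst set_integrable_cong[of lebesgue lebesgue "{a..b}" "{a..b}" g f]) auto
  moreover have "(g has_integral (G x - G a)) {a..x}" if "x \<in> {a..b}" for x
    using assms that by (subst has_integral_cong[of _ _ f]) (auto simp: AC_on_def)
  ultimately show ?thesis
    using assms(1) by (auto simp: AC_on_def)
qed

lemma continuous_mult_absolutely_integrable:
  fixes F f :: "real \<Rightarrow> complex"
  assumes "continuous_on {a..b} F" "f absolutely_integrable_on {a..b}"
  shows "(\<lambda>x. F x * f x) absolutely_integrable_on {a..b}"
proof (rule absolutely_integrable_bounded_measurable_product[where h = "(*)"])
  show "bilinear ((*) :: complex \<Rightarrow> complex \<Rightarrow> complex)"
    by (simp add: bilinear_conv_bounded_bilinear bounded_bilinear_mult)
  show "F \<in> borel_measurable (lebesgue_on {a..b})"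
    by (intro continuous_imp_measurable_on_sets_lebesgue assms) auto
  show "bounded (F ` {a..b})"
    by (intro compact_imp_bounded compact_continuous_image assms) auto
qed (use assms in auto)

text \<open>The error of the chain rule on a short interval is at most a small multiple of the integral
  of \<open>norm f\<close>, and this estimate is additive in the interval.  Bolzano's bisection lemma thus
  replaces any differentiation theorem for Lebesgue integrals.\<close>

lemma AC_on_chain:
  assumes F: "AC_on a b F f"
    and H: "\<And>z. (H has_field_derivative H' z) (at z)" and H': "continuous_on UNIV H'"
  shows "AC_on a b (\<lambda>x. H (F x)) (\<lambda>x. H' (F x) * f x)"
proof -
  let ?g = "\<lambda>x. H' (F x) * f x"
  have cF: "continuous_on {a..b} F"
    by (rule AC_on_continuous[OF F])
  have cH': "continuous_on {a..b} (\<lambda>x. H' (F x))"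
    by (rule continuous_on_compose2[OF H' cF]) auto
  have fa: "f absolutely_integrable_on {a..b}"
    by (rule AC_on_absolutely_integrable[OF F])
  have ga: "?g absolutely_integrable_on {a..b}"
    by (rule continuous_mult_absolutely_integrable[OF cH' fa])
  have fi: "f integrable_on {x..y}" "(\<lambda>x. norm (f x)) integrable_on {x..y}" "?g integrable_on {x..y}"
    if "a \<le> x" "y \<le> b" for x y
    using that fa ga integrable_subinterval_real[of _ a b x y]
    by (auto simp: absolutely_integrable_on_def)
  have key: "norm (H (F c) - H (F a) - integral {a..c} ?g) \<le> e * integral {a..c} (\<lambda>x. norm (f x))"
    if c: "c \<in> {a..b}" and e: "e > 0" for c e
  proof -
    \<comment> \<open>The bisection lemma asks for all short intervals around a point, including
      those that stick out of \<open>{a..b}\<close>; the premise makes \<open>P\<close> vacuous for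
      them.\<close>
    define P where "P x y \<longleftrightarrow> (a \<le> x \<and> y \<le> b \<longrightarrow>
      norm (H (F y) - H (F x) - integral {x..y} ?g) \<le> e * integral {x..y} (\<lambda>x. norm (f x)))" for x y
    have "a \<le> c" using c by simp
    then have "P a c"
    proof (induction rule: Bolzano)
      case (trans x y z)
      show ?case
        unfolding P_def
      proof (intro impI, elim conjE)
        assume xz: "a \<le> x" "z \<le> b"
        have 1: "integral {x..z} ?g = integral {x..y} ?g + integral {y..z} ?g"
          using trans(3,4) xz by (intro Henstock_Kurzweil_Integration.integral_combine[symmetric] fi)
        have 2: "integral {x..z} (\<lambda>x. norm (f x)) = integral {x..y} (\<lambda>x. norm (f x)) + integral {y..z} (\<lambda>x. norm (f x))"
          using trans(3,4) xz by (intro Henstock_Kurzweil_Integration.integral_combine[symmetric] fi)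
        have "H (F z) - H (F x) - integral {x..z} ?g =
          (H (F y) - H (F x) - integral {x..y} ?g) + (H (F z) - H (F y) - integral {y..z} ?g)"
          unfolding 1 by simp
        then have "norm (H (F z) - H (F x) - integral {x..z} ?g) \<le>
          norm (H (F y) - H (F x) - integral {x..y} ?g) + norm (H (F z) - H (F y) - integral {y..z} ?g)"
          by (metis norm_triangle_ineq)
        also have "\<dots> \<le> e * integral {x..y} (\<lambda>x. norm (f x)) + e * integral {y..z} (\<lambda>x. norm (f x))"
          using trans xz by (intro add_mono) (auto simp: P_def)
        finally show "norm (H (F z) - H (F x) - integral {x..z} ?g) \<le> e * integral {x..z} (\<lambda>x. norm (f x))"
          unfolding 2 by (simp add: algebra_simps)
      qed
    next
      case (local t)
      define p where "p = F t"
      have t: "t \<in> {a..b}" using local c by auto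
      obtain r where r: "r > 0" and rH: "\<And>z. dist z p < r \<Longrightarrow> dist (H' z) (H' p) < e / 2"
        using H' e unfolding continuous_on_iff by (metis UNIV_I half_gt_zero)
      obtain d where d: "d > 0" and dF: "\<And>x. x \<in> {a..b} \<Longrightarrow> dist x t < d \<Longrightarrow> dist (F x) p < r"
        using cF t r unfolding continuous_on_iff p_def by metis
      show ?case
      proof (intro exI[of _ d] conjI d allI impI, elim conjE)
        fix x y assume xy: "x \<le> t" "t \<le> y" "y - x < d"
        show "P x y"
          unfolding P_def
        proof (intro impI, elim conjE)
          assume ab: "a \<le> x" "y \<le> b"
          have near: "dist (F s) p < r" if "s \<in> {x..y}" for s
            using that xy ab by (intro dF) (auto simp: dist_real_def)
          have fint: "integral {x..y} f = F y - F x"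
            using AC_on_has_integral[OF F, of x y] xy ab by (intro integral_unique) auto
          have nf: "norm (F y - F x) \<le> integral {x..y} (\<lambda>x. norm (f x))"
            unfolding fint[symmetric] using ab
            by (intro Henstock_Kurzweil_Integration.integral_norm_bound_integral fi) auto
          \<comment> \<open>First half of the error: after subtraction of the linear map with slope
            \<open>H' p\<close>, the derivative of \<open>H\<close> is at most \<open>e / 2\<close>
            on the ball, so a mean value bound applies.\<close>
          have "norm ((H (F y) - H' p * F y) - (H (F x) - H' p * F x)) \<le> e / 2 * norm (F y - F x)"
          proof (rule field_differentiable_bound[of "ball p r" "\<lambda>z. H z - H' p * z" "\<lambda>z. H' z - H' p"])
            show "((\<lambda>z. H z - H' p * z) has_field_derivative H' z - H' p) (at z within ball p r)" for z
              by (auto intro!: derivative_eq_intros has_field_derivative_at_within[OF H])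
            show "norm (H' z - H' p) \<le> e / 2" if "z \<in> ball p r" for z
              using rH[of z] that by (auto simp: dist_norm norm_minus_commute)
            show "F y \<in> ball p r" "F x \<in> ball p r"
              using near[of x] near[of y] xy by (auto simp: dist_commute)
          qed auto
          also have "\<dots> \<le> e / 2 * integral {x..y} (\<lambda>x. norm (f x))"
            using nf e by simp
          finally have A: "norm ((H (F y) - H' p * F y) - (H (F x) - H' p * F x)) \<le> \<dots>" .
          \<comment> \<open>Second half of the error: the slope is frozen at \<open>p\<close> under
            the integral.\<close>
          have "H' p * (F y - F x) - integral {x..y} ?g = integral {x..y} (\<lambda>x. H' p * f x - ?g x)"
            unfolding fint[symmetric]
            using ab fi by (subst Henstock_Kurzweil_Integration.integral_diff) (auto intro!: integrable_on_mult_right)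
          also have "norm \<dots> \<le> integral {x..y} (\<lambda>x. e / 2 * norm (f x))"
          proof (intro Henstock_Kurzweil_Integration.integral_norm_bound_integral)
            show "(\<lambda>x. H' p * f x - ?g x) integrable_on {x..y}"
              using ab fi by (intro integrable_diff integrable_on_mult_right) auto
            show "(\<lambda>x. e / 2 * norm (f x)) integrable_on {x..y}"
              using ab fi by (intro integrable_on_mult_right) auto
            fix s assume s: "s \<in> {x..y}"
            have "norm (H' p - H' (F s)) \<le> e / 2"
              using rH[OF near[OF s]] by (simp add: dist_norm norm_minus_commute)
            then show "norm (H' p * f s - ?g s) \<le> e / 2 * norm (f s)"
              by (metis left_diff_distrib norm_mult mult_right_mono norm_ge_zero)
          qed
          also have "\<dots> = e / 2 * integral {x..y} (\<lambda>x. norm (f x))"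
            by simp
          finally have B: "norm (H' p * (F y - F x) - integral {x..y} ?g) \<le> \<dots>" .
          have "H (F y) - H (F x) - integral {x..y} ?g = ((H (F y) - H' p * F y) - (H (F x) - H' p * F x))
             + (H' p * (F y - F x) - integral {x..y} ?g)"
            by (simp add: algebra_simps)
          then have "norm (H (F y) - H (F x) - integral {x..y} ?g) \<le> 
             norm ((H (F y) - H' p * F y) - (H (F x) - H' p * F x)) + norm (H' p * (F y - F x) - integral {x..y} ?g)"
            by (metis norm_triangle_ineq)
          with A B show "norm (H (F y) - H (F x) - integral {x..y} ?g) \<le> e * integral {x..y} (\<lambda>x. norm (f x))"
            by linarith
        qed
      qed
    qed
    then show ?thesis
      using c by (simp add: P_def)
  qed
  have "(?g has_integral (H (F c) - H (F a))) {a..c}" if c: "c \<in> {a..b}" for c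
  proof -
    have "norm (H (F c) - H (F a) - integral {a..c} ?g) \<le> 0"
    proof (rule field_le_epsilon)
      fix e :: real assume e: "e > 0"
      let ?I = "integral {a..c} (\<lambda>x. norm (f x))"
      have I: "?I \<ge> 0"
        using c fi by (intro Henstock_Kurzweil_Integration.integral_nonneg) auto
      \<comment> \<open>The summand 1 in \<open>?I + 1\<close> keeps the denominator positive when
        \<open>?I = 0\<close>.\<close>
      have "norm (H (F c) - H (F a) - integral {a..c} ?g) \<le> e / (?I + 1) * ?I"
        using e I by (intro key[OF c]) auto
      also have "\<dots> \<le> 0 + e"
        using e I by (simp add: field_simps)
      finally show "norm (H (F c) - H (F a) - integral {a..c} ?g) \<le> 0 + e" .
    qed
    then show ?thesis
      using c fi(3)[of a c] by (auto simp: has_integral_iff)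
  qed
  then show ?thesis
    using ga AC_on_le[OF F] by (auto simp: AC_on_def)
qed

lemma AC_on_add:
  assumes "AC_on a b F f" "AC_on a b G g"
  shows "AC_on a b (\<lambda>x. F x + G x) (\<lambda>x. f x + g x)"
proof -
  have "((\<lambda>x. f x + g x) has_integral (F x + G x - (F a + G a))) {a..x}" if "x \<in> {a..b}" for x
    using has_integral_add[OF AC_on_has_integral[OF assms(1), of a x] AC_on_has_integral[OF assms(2), of a x]] that
    by (simp add: algebra_simps)
  then show ?thesis
    using assms by (auto simp: AC_on_def intro: set_integral_add(1))
qed

text \<open>Linearity over the reals suffices, which covers complex conjugation; that map is not
  holomorphic and so is out of reach of \<open>AC_on_chain\<close>.\<close>

lemma AC_on_linear:
  assumes "bounded_linear L" "AC_on a b F f"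
  shows "AC_on a b (\<lambda>x. L (F x)) (\<lambda>x. L (f x))"
proof -
  have "((\<lambda>x. L (f x)) has_integral (L (F x) - L (F a))) {a..x}" if "x \<in> {a..b}" for x
    using has_integral_linear[of f "F x - F a" "{a..x}" L] assms that
    by (auto simp: AC_on_def o_def linear_diff bounded_linear.linear)
  moreover have "(\<lambda>x. L (f x)) absolutely_integrable_on {a..b}"
    using absolutely_integrable_linear[OF _ assms(1)] assms(2) by (auto simp: AC_on_def o_def)
  ultimately show ?thesis
    using assms(2) by (auto simp: AC_on_def)
qed

lemmas AC_on_cmult = AC_on_linear[OF bounded_linear_mult_right]
lemmas AC_on_cnj = AC_on_linear[OF bounded_linear_cnj]

lemma AC_on_diff:
  assumes "AC_on a b F f" "AC_on a b G g"
  shows "AC_on a b (\<lambda>x. F x - G x) (\<lambda>x. f x - g x)"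
  using AC_on_add[OF assms(1) AC_on_cmult[OF assms(2), of "-1"]] by simp

text \<open>Polarization writes the product as a difference of two squares, and a square is an
  instance of the chain rule in one variable.\<close>

lemma AC_on_mult:
  assumes "AC_on a b F f" "AC_on a b G g"
  shows "AC_on a b (\<lambda>x. F x * G x) (\<lambda>x. f x * G x + F x * g x)"
proof -
  have sq: "AC_on a b (\<lambda>x. (F x)^2) (\<lambda>x. 2 * F x * f x)" if "AC_on a b F f" for F f
    by (rule AC_on_chain[OF that, where H = "\<lambda>z. z^2" and H' = "\<lambda>z. 2 * z"])
       (auto intro!: derivative_eq_intros continuous_intros)
  have "AC_on a b (\<lambda>x. 1/4 * ((F x + G x)^2 - (F x - G x)^2))
    (\<lambda>x. 1/4 * (2 * (F x + G x) * (f x + g x) - 2 * (F x - G x) * (f x - g x)))"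
    by (intro AC_on_cmult AC_on_diff[OF sq sq] AC_on_add AC_on_diff assms)
  then show ?thesis
    by (rule AC_on_cong) (simp_all add: power2_eq_square algebra_simps)
qed

lemma AC_on_C1:
  assumes "a \<le> b" "\<And>x. x \<in> {a..b} \<Longrightarrow> (F has_vector_derivative f x) (at x within {a..b})"
    and "continuous_on {a..b} f"
  shows "AC_on a b F f"
proof -
  have "(f has_integral (F x - F a)) {a..x}" if "x \<in> {a..b}" for x
    using that assms(2)
    by (intro fundamental_theorem_of_calculus)
       (auto intro: has_vector_derivative_within_subset[of F _ _ "{a..b}"])
  then show ?thesis
    using assms by (auto simp: AC_on_def intro: absolutely_integrable_continuous_real)
qed

lemma AC_on_of_real_C1:
  assumes "a \<le> b" "\<And>x. x \<in> {a..b} \<Longrightarrow> (F has_real_derivative f x) (at x within {a..b})"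
    and "continuous_on {a..b} f"
  shows "AC_on a b (\<lambda>x. of_real (F x)) (\<lambda>x. of_real (f x))"
  using assms
  by (intro AC_on_C1 has_vector_derivative_of_real continuous_intros)
     (auto simp flip: has_real_derivative_iff_has_vector_derivative)

lemma AC_on_Re_has_integral:
  assumes "AC_on a b F f"
  shows "((\<lambda>x. Re (f x)) has_integral (Re (F b) - Re (F a))) {a..b}"
proof -
  have "(f has_integral (F b - F a)) {a..b}"
    using AC_on_has_integral[OF assms, of a b] AC_on_le[OF assms] by simp
  from has_integral_linear[OF this bounded_linear_Re] show ?thesis
    by (simp add: o_def)
qed

text \<open>The form in which both lower bounds are proved: \<open>E\<close> is an energy density
  that exceeds the derivative of a boundary expression by a square.\<close>

lemma AC_on_Re_le:
  assumes "AC_on a b F f" "E integrable_on {a..b}" "\<And>x. x \<in> {a..b} \<Longrightarrow> Re (f x) \<le> E x"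
  shows "Re (F b) - Re (F a) \<le> integral {a..b} E"
  using has_integral_le[OF AC_on_Re_has_integral[OF assms(1)] integrable_integral[OF assms(2)] assms(3)] .

section \<open>Square-integrable functions\<close>

lemma L2_on_borel_measurable:
  assumes "L2_on S f" "S \<in> sets lebesgue"
  shows "f \<in> borel_measurable (lebesgue_on S)"
  using assms by (simp add: L2_on_def measurable_on_iff_borel_measurable)

lemma L2_onI:
  assumes "f \<in> borel_measurable (lebesgue_on S)" "S \<in> sets lebesgue" "h integrable_on S"
    and "\<And>x. x \<in> S \<Longrightarrow> (norm (f x))^2 \<le> h x"
  shows "L2_on S f"
  unfolding L2_on_def
proof
  show "f measurable_on S"
    using assms by (simp add: measurable_on_iff_borel_measurable)
  show "(\<lambda>x. (norm (f x))^2) integrable_on S"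
    by (rule measurable_bounded_by_integrable_imp_integrable_real[OF _ assms(3) _ assms(2)])
       (use assms in auto)
qed

lemma L2_on_subset:
  assumes "L2_on T f" "S \<subseteq> T" "S \<in> sets lebesgue" "T \<in> sets lebesgue"
  shows "L2_on S f"
proof -
  have m: "f \<in> borel_measurable (lebesgue_on S)"
    using L2_on_borel_measurable[OF assms(1,4)] assms(2) by (rule measurable_restrict_mono)
  have "(\<lambda>x. (norm (f x))^2) absolutely_integrable_on T"
    using assms(1) by (auto simp: L2_on_def intro!: nonnegative_absolutely_integrable_1)
  then have "(\<lambda>x. (norm (f x))^2) absolutely_integrable_on S"
    using assms by (auto intro: set_integrable_subset)
  then show ?thesis
    using m assms by (intro L2_onI[where h = "\<lambda>x. (norm (f x))^2"]) (auto simp: absolutely_integrable_on_def)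
qed

text \<open>On a bounded interval constants are integrable, and \<open>norm (f x)\<close> is at most
  1 plus its square.\<close>

lemma L2_on_absolutely_integrable:
  assumes "L2_on {a..b} f"
  shows "f absolutely_integrable_on {a..b}"
proof (rule measurable_bounded_by_integrable_imp_absolutely_integrable)
  show "f \<in> borel_measurable (lebesgue_on {a..b})"
    using assms by (intro L2_on_borel_measurable) auto
  show "(\<lambda>x. 1 + (norm (f x))^2) integrable_on {a..b}"
    using assms by (intro integrable_add) (auto simp: L2_on_def)
  show "norm (f x) \<le> 1 + (norm (f x))^2" for x
    using sum_squares_bound[of "norm (f x)" 1] norm_ge_zero[of "f x"] by (simp add: power2_eq_square, linarith)
qed auto

lemma L2_on_add:
  assumes "L2_on S f" "L2_on S g" "S \<in> sets lebesgue"
  shows "L2_on S (\<lambda>x. f x + g x)"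
proof (rule L2_onI[where h = "\<lambda>x. 2 * (norm (f x))^2 + 2 * (norm (g x))^2"])
  show "(\<lambda>x. f x + g x) \<in> borel_measurable (lebesgue_on S)"
    using assms by (intro borel_measurable_add L2_on_borel_measurable)
  show "(\<lambda>x. 2 * (norm (f x))^2 + 2 * (norm (g x))^2) integrable_on S"
    using assms by (intro integrable_add integrable_on_mult_right) (auto simp: L2_on_def)
  show "(norm (f x + g x))^2 \<le> 2 * (norm (f x))^2 + 2 * (norm (g x))^2" for x
  proof -
    have "(norm (f x + g x))^2 \<le> (norm (f x) + norm (g x))^2"
      by (intro power_mono norm_triangle_ineq) auto
    also have "\<dots> \<le> 2 * (norm (f x))^2 + 2 * (norm (g x))^2"
      using sum_squares_bound[of "norm (f x)" "norm (g x)"] by (simp add: power2_sum)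
    finally show ?thesis .
  qed
qed (use assms in auto)

lemma L2_on_continuous:
  assumes "continuous_on {a..b} f"
  shows "L2_on {a..b} f"
proof (rule L2_onI[where h = "\<lambda>x. (norm (f x))^2"])
  show "f \<in> borel_measurable (lebesgue_on {a..b})"
    by (intro continuous_imp_measurable_on_sets_lebesgue assms) auto
  show "(\<lambda>x. (norm (f x))^2) integrable_on {a..b}"
    by (intro integrable_continuous_interval continuous_intros assms)
qed auto

lemma L2_on_continuous_mult:
  fixes F f :: "real \<Rightarrow> complex"
  assumes "continuous_on {a..b} F" "L2_on {a..b} f"
  shows "L2_on {a..b} (\<lambda>x. F x * f x)"
proof -
  have "bounded (F ` {a..b})"
    by (intro compact_imp_bounded compact_continuous_image assms) auto
  then obtain B where B: "\<And>x. x \<in> {a..b} \<Longrightarrow> norm (F x) \<le> B"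
    unfolding bounded_iff by blast
  show ?thesis
  proof (rule L2_onI[where h = "\<lambda>x. B^2 * (norm (f x))^2"])
    show "(\<lambda>x. F x * f x) \<in> borel_measurable (lebesgue_on {a..b})"
      using assms
      by (intro borel_measurable_times L2_on_borel_measurable continuous_imp_measurable_on_sets_lebesgue) auto
    show "(\<lambda>x. B^2 * (norm (f x))^2) integrable_on {a..b}"
      using assms by (intro integrable_on_mult_right) (auto simp: L2_on_def)
    show "(norm (F x * f x))^2 \<le> B^2 * (norm (f x))^2" if "x \<in> {a..b}" for x
      using B[OF that] by (simp add: norm_mult power_mult_distrib mult_right_mono power_mono)
  qed auto
qed

lemma L2_on_of_real:
  assumes "L2_on {a..b} f"
  shows "L2_on {a..b} (\<lambda>x. complex_of_real (f x))"
proof (rule L2_onI[where h = "\<lambda>x. (norm (f x))^2"])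
  have "f \<in> borel_measurable (lebesgue_on {a..b})"
    using assms by (intro L2_on_borel_measurable) auto
  then show "(\<lambda>x. complex_of_real (f x)) \<in> borel_measurable (lebesgue_on {a..b})"
    by measurable
qed (use assms in \<open>auto simp: L2_on_def\<close>)


section \<open>The half-line\<close>

text \<open>Dominated convergence for truncations. It carries estimates from bounded intervals,
  where \<open>AC_on\<close> applies, over to the half-line.\<close>

lemma integral_atLeast_tendsto:
  fixes f :: "real \<Rightarrow> real"
  assumes "f absolutely_integrable_on {a..}"
  shows "(\<lambda>n. integral {a..a + real n} f) \<longlonglongrightarrow> integral {a..} f"
proof -
  let ?f = "\<lambda>n x. if x \<in> {a..a + real n} then f x else 0"
  have i: "f integrable_on {a..a + real n}" for n
    using set_integrable_subset[OF assms, of "{a..a + real n}"] by (auto simp: absolutely_integrable_on_def)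
  have eq: "integral {a..} (?f n) = integral {a..a + real n} f" for n
  proof -
    have "{a..a + real n} \<inter> {a..} = {a..a + real n}" by auto
    then show ?thesis
      by (subst integral_restrict_Int) simp
  qed
  have "(\<lambda>n. integral {a..} (?f n)) \<longlonglongrightarrow> integral {a..} f"
  proof (rule dominated_convergence(2)[where h = "\<lambda>x. norm (f x)"])
    show "?f n integrable_on {a..}" for n
    proof -
      have "{a..a + real n} \<inter> {a..} = {a..a + real n}" by auto
      then show ?thesis
        using i by (subst integrable_restrict_Int) simp
    qed
    show "(\<lambda>x. norm (f x)) integrable_on {a..}"
      using assms by (simp add: absolutely_integrable_on_def)
    show "(\<lambda>n. ?f n x) \<longlonglongrightarrow> f x" if "x \<in> {a..}" for x
    proof (rule tendsto_eventually)
      obtain N where "x - a \<le> real N" using real_arch_simple by blast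
      then show "\<forall>\<^sub>F n in sequentially. ?f n x = f x"
        using that by (intro eventually_sequentiallyI[of N]) auto
    qed
  qed auto
  then show ?thesis
    unfolding eq .
qed

lemma L2_on_weighted_integrable:
  assumes "L2_on {1..} u"
  shows "(\<lambda>r. (norm (u r))^2 / r^2) integrable_on {1..}"
proof (rule measurable_bounded_by_integrable_imp_integrable_real)
  have "u \<in> borel_measurable (lebesgue_on {1..})"
    using assms by (intro L2_on_borel_measurable) auto
  moreover have "(\<lambda>r::real. r) \<in> borel_measurable (lebesgue_on {1..})"
    by (intro continuous_imp_measurable_on_sets_lebesgue continuous_intros) auto
  ultimately show "(\<lambda>r. (norm (u r))^2 / r^2) \<in> borel_measurable (lebesgue_on {1..})"
    by measurable
  show "(\<lambda>r. (norm (u r))^2) integrable_on {1..}"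
    using assms by (auto simp: L2_on_def)
  show "\<bar>(norm (u r))^2 / r^2\<bar> \<le> (norm (u r))^2" if "r \<in> {1..}" for r
    using that by (simp add: divide_le_eq mult_left_le_one_le mult_le_cancel_left1)
qed auto

lemma H1_halfline_AC_on:
  assumes "H1_halfline 1 u g" "1 \<le> R"
  shows "AC_on 1 R u g"
  using assms L2_on_absolutely_integrable[OF L2_on_subset[of "{1..}" g "{1..R}"]]
  by (auto simp: AC_on_def H1_halfline_def)

lemma H1_interval_AC_on:
  assumes "H1_interval a b u g" "a \<le> b"
  shows "AC_on a b u g"
  using assms L2_on_absolutely_integrable by (auto simp: AC_on_def H1_interval_def)

text \<open>Here \<open>s\<close> is chosen such that \<open>r powr s\<close> solves \<open>- y'' = (s - s\<^sup>2) * y / r\<^sup>2\<close>; the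
  half-line estimate rests on the identity
  \<open>\<bar>g\<bar>\<^sup>2 - (s - s\<^sup>2) * \<bar>u\<bar>\<^sup>2 / r\<^sup>2 = \<bar>g - s * u / r\<bar>\<^sup>2 + (s * \<bar>u\<bar>\<^sup>2 / r)'\<close>.\<close>

lemma AC_on_norm_square_over:
  assumes "AC_on 1 R u g"
  shows "AC_on 1 R (\<lambda>r. of_real s * (u r * cnj (u r) * of_real (1 / r)))
     (\<lambda>r. of_real s * ((g r * cnj (u r) + u r * cnj (g r)) * of_real (1 / r)
        + u r * cnj (u r) * of_real (- 1 / r^2)))"
proof (intro AC_on_cmult AC_on_mult AC_on_cnj assms)
  show "AC_on 1 R (\<lambda>r. of_real (1 / r)) (\<lambda>r. of_real (- 1 / r^2))"
    using AC_on_le[OF assms]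
    by (intro AC_on_of_real_C1) (auto intro!: derivative_eq_intros continuous_intros simp: power2_eq_square)
qed

lemma norm_square_over_deriv:
  fixes u g :: complex and r s :: real
  assumes "r > 0"
  shows "Re (of_real s * ((g * cnj u + u * cnj g) * of_real (1 / r) + u * cnj u * of_real (- 1 / r^2)))
    = (cmod g)^2 - (s - s^2) * ((cmod u)^2 / r^2) - (cmod (g - of_real (s / r) * u))^2"
  using assms unfolding cmod_power2
  by (simp add: power2_eq_square field_simps)

text \<open>On \<open>{1..R}\<close> the identity above leaves a square and two boundary terms. The
  square and the boundary term at \<open>R\<close> are nonnegative and are dropped; then
  \<open>R\<close> tends to infinity.\<close>

lemma halfline_lower_bound:
  assumes H1: "H1_halfline 1 u g" and s: "0 \<le> s"
  shows "integral {1..} (\<lambda>r. (cmod (g r))^2) - (s - s^2) * integral {1..} (\<lambda>r. (cmod (u r))^2 / r^2)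
    \<ge> - s * (cmod (u 1))^2"
proof -
  define E where "E r = (cmod (g r))^2 - (s - s^2) * ((cmod (u r))^2 / r^2)" for r
  have gi: "(\<lambda>r. (cmod (g r))^2) integrable_on {1..}" and ui: "(\<lambda>r. (cmod (u r))^2 / r^2) integrable_on {1..}"
    using H1 by (auto simp: H1_halfline_def L2_on_def intro!: L2_on_weighted_integrable)
  have Ea: "E absolutely_integrable_on {1..}"
    unfolding E_def
    by (intro set_integral_diff(1) set_integrable_mult_right nonnegative_absolutely_integrable_1 gi ui) auto
  have "- s * (cmod (u 1))^2 \<le> integral {1..1 + real n} E" for n
  proof -
    let ?R = "1 + real n"
    have AC: "AC_on 1 ?R u g"
      by (rule H1_halfline_AC_on[OF H1]) auto
    have "E integrable_on {1..?R}"
      using set_integrable_subset[OF Ea, of "{1..?R}"] by (auto simp: absolutely_integrable_on_def)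
    then have "Re (of_real s * (u ?R * cnj (u ?R) * of_real (1 / ?R))) - Re (of_real s * (u 1 * cnj (u 1) * of_real (1 / 1)))
      \<le> integral {1..?R} E"
      by (rule AC_on_Re_le[OF AC_on_norm_square_over[OF AC, of s]])
         (subst norm_square_over_deriv, auto simp: E_def)
    moreover have "Re (of_real s * (u ?R * cnj (u ?R) * of_real (1 / ?R))) = s * (cmod (u ?R))^2 / ?R"
      by (subst complex_norm_square[symmetric]) (simp flip: of_real_mult of_real_power)
    moreover have "s * (cmod (u ?R))^2 / ?R \<ge> 0"
      using s by simp
    moreover have "Re (of_real s * (u 1 * cnj (u 1) * of_real (1 / 1))) = s * (cmod (u 1))^2"
      by (subst complex_norm_square[symmetric]) (simp flip: of_real_mult of_real_power)
    ultimately show ?thesis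
      by linarith
  qed
  then have "- s * (cmod (u 1))^2 \<le> integral {1..} E"
    by (intro LIMSEQ_le_const[OF integral_atLeast_tendsto[OF Ea]]) auto
  also have "integral {1..} E = integral {1..} (\<lambda>r. (cmod (g r))^2) - (s - s^2) * integral {1..} (\<lambda>r. (cmod (u r))^2 / r^2)"
    unfolding E_def integral_mult_right[symmetric]
    by (intro Henstock_Kurzweil_Integration.integral_diff gi integrable_on_mult_right ui)
  finally show ?thesis .
qed

text \<open>The trial function is \<open>r powr s\<close> times a slowly decaying rational cut-off.
  The square in the identity is then the only error besides a vanishing boundary term, and its
  integral is small with the cut-off parameter \<open>d\<close>.\<close>

lemma halfline_trial:
  assumes s: "0 \<le> s" "s < 1/2" and e: "0 < e"
  obtains u g where "H1_halfline 1 u g" "u 1 = 1"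
    "integral {1..} (\<lambda>r. (cmod (g r))^2) - (s - s^2) * integral {1..} (\<lambda>r. (cmod (u r))^2 / r^2) \<le> - s + e"
proof -
  \<comment> \<open>The quantity made small here is the integral of the majorant \<open>D\<close> of
    the error below.\<close>
  have "((\<lambda>d. d powr (1/2 - s) / (1/2 - s)) \<longlongrightarrow> 0) (at_right 0)"
    using s by real_asymp
  then have "\<forall>\<^sub>F d in at_right 0. d powr (1/2 - s) / (1/2 - s) < e"
    using e by (rule order_tendstoD(2))
  moreover have "\<forall>\<^sub>F d::real in at_right 0. 0 < d \<and> d < 1"
    using eventually_at_right_real[of 0 1] by auto
  ultimately have "\<forall>\<^sub>F d in at_right 0. d powr (1/2 - s) / (1/2 - s) < e \<and> 0 < d \<and> d < 1"
    by eventually_elim auto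
  then obtain d where d: "d powr (1/2 - s) / (1/2 - s) < e" "0 < d" "d < 1"
    using eventually_happens trivial_limit_at_right_real by blast
  \<comment> \<open>Equal to 1 at the junction and of order \<open>1 / (d * r)\<close> at infinity,
    so that \<open>U\<close> decays like \<open>r powr (s - 1)\<close>.\<close>
  define \<zeta> where "\<zeta> r = 1 / (1 + d * (r - 1))" for r
  define U where "U r = r powr s * \<zeta> r" for r
  \<comment> \<open>The derivative of \<open>U\<close>, obtained from \<open>s / r\<close> and
    \<open>- d * \<zeta> r\<close>, the logarithmic derivatives of the two factors.\<close>
  define G where "G r = s / r * U r - d * \<zeta> r * U r" for r
  have den: "1 + d * (r - 1) \<ge> 1" "1 + d * (r - 1) \<ge> d * r" if "r \<ge> 1" for r
    using that d by (auto simp: algebra_simps)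
  have \<zeta>: "0 < \<zeta> r" "\<zeta> r \<le> 1" "\<zeta> r \<le> 1 / (d * r)" if "r \<ge> 1" for r
  proof -
    have pos: "0 < 1 + d * (r - 1)" "0 < d * r"
      using den(1)[OF that] that d by (linarith, simp)
    show "0 < \<zeta> r" "\<zeta> r \<le> 1"
      using pos den(1)[OF that] unfolding \<zeta>_def by (simp_all only: zero_less_divide_1_iff divide_le_eq_1_pos)
    show "\<zeta> r \<le> 1 / (d * r)"
      using pos den(2)[OF that] unfolding \<zeta>_def by (intro divide_left_mono mult_pos_pos[OF pos]) auto
  qed
  have U0: "0 < U r" if "r \<ge> 1" for r
    using \<zeta>[OF that] that by (simp add: U_def)
  have G_le: "\<bar>G r\<bar> \<le> U r" if "r \<ge> 1" for r
  proof -
    have "s / r * U r \<le> 1 * U r" "d * \<zeta> r * U r \<le> 1 * U r" 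
      using that U0[OF that] \<zeta>[OF that] s d by (auto intro!: mult_right_mono mult_le_one simp: divide_le_eq)
    moreover have "0 \<le> s / r * U r" "0 \<le> d * \<zeta> r * U r"
      using that U0[OF that] \<zeta>[OF that] s d by auto
    ultimately show ?thesis by (simp add: G_def)
  qed
  have der: "(U has_real_derivative G r) (at r within A)" if "r \<ge> 1" for r A
  proof -
    have "1 + d * (r - 1) \<noteq> 0" using den(1)[OF that] by linarith
    then have "(\<zeta> has_real_derivative - (d * (\<zeta> r)^2)) (at r within A)"
      unfolding \<zeta>_def[abs_def] by (auto intro!: derivative_eq_intros simp: power2_eq_square)
    moreover have "((\<lambda>r. r powr s) has_real_derivative s * r powr (s - 1)) (at r within A)"
      using that by (intro has_field_derivative_at_within[OF has_real_derivative_powr]) auto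
    ultimately have "(U has_real_derivative s * r powr (s - 1) * \<zeta> r + - (d * (\<zeta> r)^2) * r powr s) (at r within A)"
      unfolding U_def[abs_def] by (rule DERIV_mult[rotated])
    moreover have "r powr (s - 1) = r powr s / r"
      using that by (simp add: powr_diff)
    ultimately show ?thesis
      by (simp add: G_def U_def power2_eq_square mult_ac)
  qed
  have c\<zeta>: "continuous_on A \<zeta>" if "A \<subseteq> {1..}" for A
  proof -
    have "\<forall>r\<in>A. 1 + d * (r - 1) \<noteq> 0" using den(1) that by fastforce
    then show ?thesis unfolding \<zeta>_def[abs_def] by (intro continuous_intros)
  qed
  have cU: "continuous_on A U" if "A \<subseteq> {1..}" for A
    unfolding U_def[abs_def] using that by (intro continuous_intros c\<zeta>) auto
  have cG: "continuous_on A G" if "A \<subseteq> {1..}" for A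
    unfolding G_def[abs_def] using that by (intro continuous_intros c\<zeta> cU) auto
  have powr_sq: "(r powr s)^2 = r powr (2 * s)" for r
    by (simp add: power2_eq_square flip: powr_add)
  have U_sq: "(U r)^2 \<le> 1 / d^2 * r powr (2 * s - 2)" if "r \<ge> 1" for r
  proof -
    have "(U r)^2 \<le> (r powr s * (1 / (d * r)))^2"
      unfolding U_def using \<zeta>[OF that] by (intro power_mono mult_left_mono) auto
    also have "\<dots> = 1 / d^2 * r powr (2 * s - 2)"
      using that by (simp add: power_mult_distrib power_divide powr_diff powr_sq)
    finally show ?thesis .
  qed
  \<comment> \<open>The exponent is below -1 because \<open>s < 1/2\<close>. The same majorant
    serves for \<open>u\<close> and for \<open>g\<close>, since \<open>G\<close> is bounded by
    \<open>U\<close>.\<close>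
  have bi: "(\<lambda>r. 1 / d^2 * r powr (2 * s - 2)) integrable_on {1..}"
    using has_integral_powr_to_inf[of "2 * s - 2" 1] s
    by (intro integrable_on_mult_right) (auto simp: integrable_on_def)
  define u where "u r = complex_of_real (U r)" for r
  define g where "g r = complex_of_real (G r)" for r
  have "L2_on {1..} u"
  proof (rule L2_onI[OF _ _ bi])
    show "u \<in> borel_measurable (lebesgue_on {1..})"
      unfolding u_def[abs_def]
      by (intro continuous_imp_measurable_on_sets_lebesgue continuous_intros cU) auto
  qed (use U_sq in \<open>auto simp: u_def\<close>)
  moreover have "L2_on {1..} g"
  proof (rule L2_onI[OF _ _ bi])
    show "g \<in> borel_measurable (lebesgue_on {1..})"
      unfolding g_def[abs_def]
      by (intro continuous_imp_measurable_on_sets_lebesgue continuous_intros cG) auto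
    show "(norm (g r))^2 \<le> 1 / d^2 * r powr (2 * s - 2)" if "r \<in> {1..}" for r
      using U_sq[of r] power_mono[OF G_le[of r], of 2] that by (simp add: g_def)
  qed auto
  moreover have "(g has_integral (u x - u 1)) {1..x}" if "x \<in> {1..}" for x
    using that unfolding u_def g_def
    by (intro fundamental_theorem_of_calculus has_vector_derivative_of_real)
       (auto simp flip: has_real_derivative_iff_has_vector_derivative intro: der)
  ultimately have H1: "H1_halfline 1 u g"
    by (simp add: H1_halfline_def)
  define E where "E r = (cmod (g r))^2 - (s - s^2) * ((cmod (u r))^2 / r^2)" for r
  define D where "D r = d powr (1/2 - s) * r powr (s - 3/2)" for r
  have D: "(D has_integral (d powr (1/2 - s) / (1/2 - s))) {1..}"
  proof -
    have "((\<lambda>r. r powr (s - 3/2)) has_integral - (1 powr (s - 3/2 + 1)) / (s - 3/2 + 1)) {1..}"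
      using s by (intro has_integral_powr_to_inf) auto
    also have "- (1 powr (s - 3/2 + 1)) / (s - 3/2 + 1) = 1 / (1/2 - s)"
      using s by (simp add: divide_simps)
    finally show ?thesis
      unfolding D_def[abs_def] using has_integral_mult_right[of _ "1 / (1/2 - s)" _ "d powr (1/2 - s)"] by simp
  qed
  have gi: "(\<lambda>r. (cmod (g r))^2) integrable_on {1..}" and ui: "(\<lambda>r. (cmod (u r))^2 / r^2) integrable_on {1..}"
    using H1 by (auto simp: H1_halfline_def L2_on_def intro!: L2_on_weighted_integrable)
  have Ea: "E absolutely_integrable_on {1..}"
    unfolding E_def
    by (intro set_integral_diff(1) set_integrable_mult_right nonnegative_absolutely_integrable_1 gi ui) auto
  have error_le: "(cmod (g r - of_real (s / r) * u r))^2 \<le> D r" if r: "r \<ge> 1" for r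
  proof -
    have "g r - of_real (s / r) * u r = of_real (- (d * r powr s * (\<zeta> r)^2))"
      by (simp add: g_def u_def G_def U_def power2_eq_square)
    then have "(cmod (g r - of_real (s / r) * u r))^2 = (d * r powr s * (\<zeta> r)^2)^2"
      by (simp only: norm_of_real power2_abs power2_minus)
    also have "\<dots> = d^2 * r powr (2 * s) * (\<zeta> r)^4"
      by (simp add: power_mult_distrib powr_sq flip: power_mult)
    also have "(\<zeta> r)^4 = (\<zeta> r) powr 4"
      using \<zeta>[OF r] by simp
    \<comment> \<open>An exponent \<open>p\<close> leads to the bound
      \<open>d powr (2 - p) * r powr (2 * s - p)\<close>, which is small with \<open>d\<close> for
      \<open>p < 2\<close> and integrable for \<open>p > 2 * s + 1\<close>; \<open>s + 3/2\<close>
      is the midpoint of this range.\<close>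
    also have "\<dots> \<le> (\<zeta> r) powr (s + 3/2)"
      using \<zeta>[OF r] s by (intro powr_mono') auto
    also have "\<dots> \<le> (1 / (d * r)) powr (s + 3/2)"
      using \<zeta>[OF r] s by (intro powr_mono2) auto
    finally have "(cmod (g r - of_real (s / r) * u r))^2 \<le> d^2 * r powr (2 * s) * (1 / (d * r)) powr (s + 3/2)"
      by (simp add: mult_left_mono)
    also have "(1 / (d * r)) powr (s + 3/2) = d powr - (s + 3/2) * r powr - (s + 3/2)"
      using d r by (simp add: powr_divide powr_mult powr_minus_divide del: minus_add_distrib)
    also have "d^2 = d powr 2"
      using d by simp
    also have "d powr 2 * r powr (2 * s) * (d powr - (s + 3/2) * r powr - (s + 3/2))
      = d powr (2 + - (s + 3/2)) * r powr (2 * s + - (s + 3/2))"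
      unfolding powr_add by (simp only: mult_ac)
    also have "2 + - (s + 3/2) = 1/2 - s"
      by simp
    also have "2 * s + - (s + 3/2) = s - 3/2"
      by simp
    finally show ?thesis
      unfolding D_def .
  qed
  \<comment> \<open>For an upper bound the boundary term at the right end has to be estimated: it is
    at most \<open>?R powr (2 * s - 1)\<close>, which tends to 0 because
    \<open>s < 1/2\<close>.\<close>
  have "integral {1..1 + real n} E \<le> (1 + real n) powr (2 * s - 1) - s + e" for n
  proof -
    let ?R = "1 + real n"
    let ?F = "\<lambda>r. of_real s * (u r * cnj (u r) * of_real (1 / r))"
    have AC: "AC_on 1 ?R u g"
      by (rule H1_halfline_AC_on[OF H1]) auto
    have Ei: "E integrable_on {1..?R}"
      using set_integrable_subset[OF Ea, of "{1..?R}"] by (auto simp: absolutely_integrable_on_def)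
    have Di: "D integrable_on {1..?R}"
      using D integrable_on_subinterval[of D "{1..}" 1 ?R] by (auto simp: integrable_on_def)
    have "integral {1..?R} E - integral {1..?R} D = integral {1..?R} (\<lambda>r. E r - D r)"
      using Ei Di by (simp add: Henstock_Kurzweil_Integration.integral_diff)
    also have "\<dots> \<le> Re (?F ?R) - Re (?F 1)"
    proof (rule has_integral_le[OF integrable_integral AC_on_Re_has_integral[OF AC_on_norm_square_over[OF AC, of s]]])
      show "(\<lambda>r. E r - D r) integrable_on {1..?R}"
        using Ei Di by (rule integrable_diff)
      fix r assume "r \<in> {1..?R}"
      then have r: "r \<ge> 1" by simp
      then show "E r - D r \<le> Re (of_real s * ((g r * cnj (u r) + u r * cnj (g r)) * of_real (1 / r)
        + u r * cnj (u r) * of_real (- 1 / r^2)))"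
        using error_le[OF r] by (subst norm_square_over_deriv) (auto simp: E_def)
    qed
    finally have "integral {1..?R} E - integral {1..?R} D \<le> Re (?F ?R) - Re (?F 1)" .
    moreover have "Re (?F ?R) = s * (U ?R)^2 / ?R" "Re (?F 1) = s"
      by (simp_all add: u_def U_def \<zeta>_def power2_eq_square)
    moreover have "s * (U ?R)^2 / ?R \<le> ?R powr (2 * s - 1)"
    proof -
      have "(U ?R)^2 \<le> (?R powr s * 1)^2"
        unfolding U_def using \<zeta>[of ?R] by (intro power_mono mult_left_mono) auto
      then have "s * (U ?R)^2 \<le> 1 * (?R powr s * 1)^2"
        using s by (intro mult_mono) auto
      then have "s * (U ?R)^2 / ?R \<le> (?R powr s)^2 / ?R"
        by (intro divide_right_mono) auto
      also have "\<dots> = ?R powr (2 * s - 1)"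
        by (simp add: powr_diff powr_sq)
      finally show ?thesis .
    qed
    moreover have "integral {1..?R} D \<le> integral {1..} D"
      using D Di by (intro integral_subset_le) (auto simp: D_def integrable_on_def)
    moreover have "integral {1..} D < e"
      using D d(1) by (simp add: integral_unique)
    ultimately show ?thesis
      by linarith
  qed
  moreover have "(\<lambda>n. (1 + real n) powr (2 * s - 1) - s + e) \<longlonglongrightarrow> 0 - s + e"
    using s by (intro tendsto_intros) real_asymp
  ultimately have "integral {1..} E \<le> 0 - s + e"
    by (intro LIMSEQ_le[OF integral_atLeast_tendsto[OF Ea]]) auto
  moreover have "integral {1..} E = integral {1..} (\<lambda>r. (cmod (g r))^2) - (s - s^2) * integral {1..} (\<lambda>r. (cmod (u r))^2 / r^2)"
    unfolding E_def integral_mult_right[symmetric]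
    by (intro Henstock_Kurzweil_Integration.integral_diff gi integrable_on_mult_right ui)
  moreover have "u 1 = 1"
    by (simp add: u_def U_def \<zeta>_def)
  ultimately show ?thesis
    using that[OF H1] by simp
qed

section \<open>The circle\<close>

text \<open>For \<open>sin (2 * pi * k)\<close> nonzero, this is the solution of
  \<open>w'' = - k^2 * w\<close> on \<open>{0..2 * pi}\<close> with end values \<open>z0\<close> and
  \<open>z1\<close>.\<close>

definition sine_interp :: "real \<Rightarrow> complex \<Rightarrow> complex \<Rightarrow> real \<Rightarrow> complex" where
  "sine_interp k z0 z1 t =
     (z0 * of_real (sin (k * (2 * pi - t))) + z1 * of_real (sin (k * t))) / of_real (sin (2 * pi * k))"

definition sine_interp' :: "real \<Rightarrow> complex \<Rightarrow> complex \<Rightarrow> real \<Rightarrow> complex" where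
  "sine_interp' k z0 z1 t =
     (z0 * of_real (- k * cos (k * (2 * pi - t))) + z1 * of_real (k * cos (k * t))) / of_real (sin (2 * pi * k))"

lemma AC_on_sine_interp:
  "AC_on 0 (2 * pi) (sine_interp k z0 z1) (sine_interp' k z0 z1)"
  unfolding sine_interp_def[abs_def] sine_interp'_def[abs_def] divide_inverse
  by (intro AC_on_linear[OF bounded_linear_mult_left] AC_on_add AC_on_cmult AC_on_of_real_C1)
     (auto intro!: derivative_eq_intros continuous_intros)

lemma AC_on_sine_interp':
  "AC_on 0 (2 * pi) (sine_interp' k z0 z1) (\<lambda>t. - of_real (k^2) * sine_interp k z0 z1 t)"
proof -
  have "AC_on 0 (2 * pi) (sine_interp' k z0 z1)
    (\<lambda>t. (z0 * of_real (- k * (k * sin (k * (2 * pi - t)))) + z1 * of_real (- k * (k * sin (k * t)))) / of_real (sin (2 * pi * k)))"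
    unfolding sine_interp'_def[abs_def] divide_inverse
    by (intro AC_on_linear[OF bounded_linear_mult_left] AC_on_add AC_on_cmult AC_on_of_real_C1)
       (auto intro!: derivative_eq_intros continuous_intros)
  then show ?thesis
    by (rule AC_on_cong) (auto simp: sine_interp_def power2_eq_square add_divide_distrib diff_divide_distrib algebra_simps)
qed

lemma continuous_on_sine_interp:
  "continuous_on {0..2 * pi} (sine_interp k z0 z1)" "continuous_on {0..2 * pi} (sine_interp' k z0 z1)"
  by (rule AC_on_continuous[OF AC_on_sine_interp] AC_on_continuous[OF AC_on_sine_interp'])+

lemma sine_interp_ends:
  assumes "sin (2 * pi * k) \<noteq> 0"
  shows "sine_interp k z0 z1 0 = z0" "sine_interp k z0 z1 (2 * pi) = z1"
  using assms by (simp_all add: sine_interp_def mult.commute)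

text \<open>This boundary term of Green's formula is the least energy on the circle for given end
  values; it enters both the lower bound and the energy of the trial function.\<close>

lemma sine_interp_boundary_term:
  assumes "sin (2 * pi * k) \<noteq> 0"
  shows "Re (sine_interp' k z0 z1 (2 * pi) * cnj (sine_interp k z0 z1 (2 * pi)))
       - Re (sine_interp' k z0 z1 0 * cnj (sine_interp k z0 z1 0))
     = k / sin (2 * pi * k) * (((cmod z0)^2 + (cmod z1)^2) * cos (2 * pi * k) - 2 * Re (z0 * cnj z1))"
proof -
  have eqs: "sine_interp' k z0 z1 (2 * pi) = of_real (k / sin (2 * pi * k)) * (z1 * of_real (cos (2 * pi * k)) - z0)"
    "sine_interp' k z0 z1 0 = of_real (k / sin (2 * pi * k)) * (z1 - z0 * of_real (cos (2 * pi * k)))"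
    using assms by (simp_all add: sine_interp'_def field_simps)
  show ?thesis
    unfolding sine_interp_ends[OF assms] eqs cmod_power2
    by (simp add: power2_eq_square add_divide_distrib algebra_simps)
qed

text \<open>Writing \<open>v = w + \<phi>\<close> with \<open>w\<close> the solution of \<open>w'' = - k\<^sup>2 * w\<close> having the boundary values of \<open>v\<close>
  and \<open>q = p' / p\<close> for the positive solution \<open>p = cos (k * (t - pi))\<close> of the same equation,
  the integrand equals \<open>\<bar>\<phi>' - q * \<phi>\<bar>\<^sup>2\<close> plus the derivative of
  \<open>2 * Re (\<phi> * cnj w') + Re (w' * cnj w) + q * \<bar>\<phi>\<bar>\<^sup>2\<close>.\<close>

lemma circle_lower_bound:
  assumes v: "AC_on 0 (2 * pi) v g" and gi: "(\<lambda>t. (cmod (g t))^2) integrable_on {0..2 * pi}"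
    and k: "0 < k" "k < 1/2"
  shows "integral {0..2 * pi} (\<lambda>t. (cmod (g t))^2) - k^2 * integral {0..2 * pi} (\<lambda>t. (cmod (v t))^2)
    \<ge> k / sin (2 * pi * k) * (((cmod (v 0))^2 + (cmod (v (2 * pi)))^2) * cos (2 * pi * k)
        - 2 * Re (v 0 * cnj (v (2 * pi))))"
proof -
  have "sin (2 * pi * k) > 0"
    using k by (intro sin_gt_zero) auto
  then have sk: "sin (2 * pi * k) \<noteq> 0" by simp
  define w where "w = sine_interp k (v 0) (v (2 * pi))"
  define w' where "w' = sine_interp' k (v 0) (v (2 * pi))"
  define q where "q t = - k * tan (k * (t - pi))" for t
  define \<phi> where "\<phi> t = v t - w t" for t
  define E where "E t = (cmod (g t))^2 - k^2 * (cmod (v t))^2" for t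
  have cv: "continuous_on {0..2 * pi} v"
    by (rule AC_on_continuous[OF v])
  have vi: "(\<lambda>t. k^2 * (cmod (v t))^2) integrable_on {0..2 * pi}"
    by (intro integrable_continuous_interval continuous_intros cv)
  have Ei: "E integrable_on {0..2 * pi}"
    unfolding E_def by (intro integrable_diff gi vi)
  have w: "AC_on 0 (2 * pi) w w'" and w': "AC_on 0 (2 * pi) w' (\<lambda>t. - of_real (k^2) * w t)"
    unfolding w_def w'_def by (rule AC_on_sine_interp AC_on_sine_interp')+
  have \<phi>: "AC_on 0 (2 * pi) \<phi> (\<lambda>t. g t - w' t)"
    unfolding \<phi>_def by (intro AC_on_diff v w)
  \<comment> \<open>The bound \<open>k < 1/2\<close> keeps the argument strictly between
    \<open>- pi / 2\<close> and \<open>pi / 2\<close> on the closed interval, so \<open>q\<close>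
    has no pole there.\<close>
  have cpos: "cos (k * (t - pi)) > 0" if "t \<in> {0..2 * pi}" for t
  proof (rule cos_gt_zero_pi)
    have "k * \<bar>t - pi\<bar> \<le> k * pi" "k * pi < 1/2 * pi"
      using k that by (auto intro!: mult_left_mono mult_strict_right_mono simp del: mult_less_cancel_right)
    moreover have "\<bar>k * (t - pi)\<bar> = k * \<bar>t - pi\<bar>"
      using k by (simp add: abs_mult)
    ultimately have "\<bar>k * (t - pi)\<bar> < pi / 2"
      by linarith
    then show "- (pi / 2) < k * (t - pi)" "k * (t - pi) < pi / 2"
      by linarith+
  qed
  \<comment> \<open>As the logarithmic derivative of a solution of \<open>p'' = - k^2 * p\<close>,
    \<open>q\<close> satisfies the Riccati equation \<open>q' = - k^2 - q^2\<close>.\<close>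
  have q: "AC_on 0 (2 * pi) (\<lambda>t. of_real (q t)) (\<lambda>t. of_real (- (k^2) - (q t)^2))"
  proof (rule AC_on_of_real_C1)
    fix t assume t: "t \<in> {0..2 * pi}"
    have c: "cos (k * (t - pi)) \<noteq> 0" using cpos[OF t] by simp
    have "(q has_real_derivative - k * (k / (cos (k * (t - pi)))^2)) (at t within {0..2 * pi})"
      unfolding q_def[abs_def] using c
      by (auto intro!: derivative_eq_intros simp: divide_simps)
    moreover have "- k * (k / (cos (k * (t - pi)))^2) = - (k^2) - (q t)^2"
      using arg_cong[OF tan_sec[OF c], of "\<lambda>x. - (k^2) * x"]
      unfolding q_def by (simp add: power_mult_distrib power_inverse distrib_left divide_inverse power2_eq_square mult_ac)
    ultimately show "(q has_real_derivative - (k^2) - (q t)^2) (at t within {0..2 * pi})"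
      by simp
  next
    have "\<forall>t\<in>{0..2 * pi}. cos (k * (t - pi)) \<noteq> 0"
      using cpos by force
    then have "continuous_on {0..2 * pi} q"
      unfolding q_def[abs_def] by (intro continuous_intros)
    then show "continuous_on {0..2 * pi} (\<lambda>t. - (k^2) - (q t)^2)"
      by (intro continuous_intros)
  qed auto
  define Q where "Q t = 2 * (\<phi> t * cnj (w' t)) + w' t * cnj (w t) + of_real (q t) * (\<phi> t * cnj (\<phi> t))" for t
  have Q: "AC_on 0 (2 * pi) Q (\<lambda>t. 2 * ((g t - w' t) * cnj (w' t) + \<phi> t * cnj (- of_real (k^2) * w t))
      + (- of_real (k^2) * w t * cnj (w t) + w' t * cnj (w' t))
      + (of_real (- (k^2) - (q t)^2) * (\<phi> t * cnj (\<phi> t))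
         + of_real (q t) * ((g t - w' t) * cnj (\<phi> t) + \<phi> t * cnj (g t - w' t))))"
    unfolding Q_def by (intro AC_on_add AC_on_cmult AC_on_mult AC_on_cnj \<phi> w w' q)
  have "Re (Q (2 * pi)) - Re (Q 0) \<le> integral {0..2 * pi} E"
  proof (rule AC_on_Re_le[OF Q Ei])
    fix t
    \<comment> \<open>Free variables reduce the identity to algebra in real and imaginary parts. The
      square subtracted on the left is what the inequality discards.\<close>
    have id: "(cmod G)^2 - k^2 * (cmod V)^2 - (cmod ((G - W') - of_real r * (V - W)))^2
       = Re (2 * ((G - W') * cnj W' + (V - W) * cnj (- of_real (k^2) * W))
      + (- of_real (k^2) * W * cnj W + W' * cnj W')
      + (of_real (- (k^2) - r^2) * ((V - W) * cnj (V - W))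
         + of_real r * ((G - W') * cnj (V - W) + (V - W) * cnj (G - W'))))" for G V W W' :: complex and r :: real
      unfolding cmod_power2 by (simp add: power2_eq_square algebra_simps)
    show "Re (2 * ((g t - w' t) * cnj (w' t) + \<phi> t * cnj (- of_real (k^2) * w t))
      + (- of_real (k^2) * w t * cnj (w t) + w' t * cnj (w' t))
      + (of_real (- (k^2) - (q t)^2) * (\<phi> t * cnj (\<phi> t))
         + of_real (q t) * ((g t - w' t) * cnj (\<phi> t) + \<phi> t * cnj (g t - w' t)))) \<le> E t"
      unfolding \<phi>_def E_def id[symmetric] by simp
  qed
  \<comment> \<open>Since \<open>\<phi>\<close> vanishes at both ends, only the term
    \<open>w' * cnj w\<close> of \<open>Q\<close> contributes.\<close>
  moreover have "\<phi> 0 = 0" "\<phi> (2 * pi) = 0"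
    using sine_interp_ends[OF sk] by (simp_all add: \<phi>_def w_def)
  then have "Re (Q (2 * pi)) - Re (Q 0) = k / sin (2 * pi * k) * (((cmod (v 0))^2 + (cmod (v (2 * pi)))^2) * cos (2 * pi * k)
        - 2 * Re (v 0 * cnj (v (2 * pi))))"
    unfolding Q_def w_def w'_def sine_interp_boundary_term[OF sk, symmetric] by simp
  moreover have "integral {0..2 * pi} E = integral {0..2 * pi} (\<lambda>t. (cmod (g t))^2) - k^2 * integral {0..2 * pi} (\<lambda>t. (cmod (v t))^2)"
    unfolding E_def using gi vi by (subst Henstock_Kurzweil_Integration.integral_diff) auto
  ultimately show ?thesis
    by simp
qed

text \<open>Equality in \<open>circle_lower_bound\<close>: the derivative of
  \<open>w' * cnj w\<close> has real part equal to the energy density, so integration by parts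
  leaves the boundary term alone.\<close>

lemma sine_interp_energy:
  assumes sk: "sin (2 * pi * k) \<noteq> 0"
  shows "integral {0..2 * pi} (\<lambda>t. (cmod (sine_interp' k z0 z1 t))^2)
      - k^2 * integral {0..2 * pi} (\<lambda>t. (cmod (sine_interp k z0 z1 t))^2)
    = k / sin (2 * pi * k) * (((cmod z0)^2 + (cmod z1)^2) * cos (2 * pi * k) - 2 * Re (z0 * cnj z1))"
proof -
  let ?w = "sine_interp k z0 z1" and ?w' = "sine_interp' k z0 z1"
  have "AC_on 0 (2 * pi) (\<lambda>t. ?w' t * cnj (?w t)) (\<lambda>t. - of_real (k^2) * ?w t * cnj (?w t) + ?w' t * cnj (?w' t))"
    by (intro AC_on_mult AC_on_cnj AC_on_sine_interp AC_on_sine_interp')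
  from AC_on_Re_has_integral[OF this]
  have "((\<lambda>t. (cmod (?w' t))^2 - k^2 * (cmod (?w t))^2) has_integral
    k / sin (2 * pi * k) * (((cmod z0)^2 + (cmod z1)^2) * cos (2 * pi * k) - 2 * Re (z0 * cnj z1))) {0..2 * pi}"
    unfolding sine_interp_boundary_term[OF sk]
    by (rule has_integral_eq[rotated]) (unfold cmod_power2, simp add: power2_eq_square algebra_simps)
  moreover have "integral {0..2 * pi} (\<lambda>t. (cmod (?w' t))^2 - k^2 * (cmod (?w t))^2)
     = integral {0..2 * pi} (\<lambda>t. (cmod (?w' t))^2) - k^2 * integral {0..2 * pi} (\<lambda>t. (cmod (?w t))^2)"
    by (subst Henstock_Kurzweil_Integration.integral_diff)
       (auto intro!: integrable_continuous_interval continuous_intros continuous_on_sine_interp)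
  ultimately show ?thesis
    by (simp add: integral_unique)
qed

section \<open>The secular equation\<close>

text \<open>The sign of the derivative reduces to \<open>sin (2 * t) \<le> 2 * t\<close>.\<close>

lemma x_cot_x_antimono:
  fixes x y :: real
  assumes "0 < x" "x \<le> y" "y < pi"
  shows "y * cos y / sin y \<le> x * cos x / sin x"
proof (rule DERIV_nonpos_imp_nonincreasing[OF assms(2)])
  fix t assume t: "x \<le> t" "t \<le> y"
  have s: "sin t > 0" using t assms by (intro sin_gt_zero) auto
  have "((\<lambda>t. t * cos t / sin t) has_real_derivative (sin t * cos t - t) / (sin t)^2) (at t)"
  proof -
    have "((\<lambda>t. t * cos t / sin t) has_real_derivative
        (((cos t - t * sin t) * sin t - t * cos t * cos t) / (sin t * sin t))) (at t)"
      using s by (auto intro!: derivative_eq_intros)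
    moreover have "(cos t - t * sin t) * sin t - t * cos t * cos t = sin t * cos t - t * ((sin t)^2 + (cos t)^2)"
      unfolding power2_eq_square by (simp only: algebra_simps)
    ultimately show ?thesis
      by (simp add: power2_eq_square[of "sin t", symmetric])
  qed
  moreover have "sin t * cos t \<le> t"
  proof -
    have "sin (2 * t) \<le> 2 * t"
      using t assms by (intro sin_x_le_x) auto
    then show ?thesis by (simp add: sin_double)
  qed
  ultimately show "\<exists>y. ((\<lambda>t. t * cos t / sin t) has_real_derivative y) (at t) \<and> y \<le> 0"
    using s by (intro exI conjI) (auto simp: divide_nonpos_pos)
qed

text \<open>The sum of the two boundary terms in half-angle form, where each of the three summands is
  visibly monotone in \<open>k\<close> and \<open>\<beta> = 1/2\<close> needs no separate treatment (the spurious zero of the original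
  equation at \<open>k = 1/2\<close> is divided out).\<close>

definition secular :: "real \<Rightarrow> real \<Rightarrow> real" where
  "secular \<beta> k = (sin (pi * \<beta>))^2 * (2 * k * cos (pi * k) / sin (pi * k))
     - (cos (pi * \<beta>))^2 * (2 * k * tan (pi * k)) - (1 - sqrt (1 - 4 * k^2)) / 2"

text \<open>For \<open>0 < k < 1/2\<close> both \<open>sin (pi * k)\<close> and
  \<open>cos (pi * k)\<close> are positive, so their product can be cleared from the denominator;
  the double-angle formulas do the rest.\<close>

lemma secular_eq_0_iff:
  assumes "0 < k" "k < 1/2"
  shows "secular \<beta> k = 0 \<longleftrightarrow>
    cos (2*pi*\<beta>) = cos (2 * pi * k) - (1 - sqrt (1 - 4*k^2)) / (4 * k) * sin (2 * pi * k)"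
proof -
  define y where "y = pi * k"
  define S where "S = (sin (pi * \<beta>))^2"
  define \<sigma> where "\<sigma> = 1 - sqrt (1 - 4 * k^2)"
  have "sin y > 0" "cos y > 0"
    using assms by (auto simp: y_def intro!: sin_gt_zero cos_gt_zero)
  then have p: "sin y * cos y > 0" by simp
  have C: "(cos (pi * \<beta>))^2 = 1 - S" "(cos y)^2 = 1 - (sin y)^2"
    by (simp_all add: S_def cos_squared_eq)
  have e1: "cos (2 * pi * \<beta>) = 1 - 2 * S" "cos (2 * pi * k) = 1 - 2 * (sin y)^2" "sin (2 * pi * k) = 2 * (sin y * cos y)"
    using cos_double_sin[of "pi * \<beta>"] cos_double_sin[of y] sin_double[of y] by (simp_all add: S_def y_def mult.assoc)
  have split: "A * (2 * k * c / s) - B * (2 * k * (s / c)) = 2 * k * (A * c^2 - B * s^2) / (s * c)"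
    if "s > 0" "c > 0" for A B s c :: real
    using that by (simp add: field_simps power2_eq_square)
  have "secular \<beta> k = 2 * k * (S * (cos y)^2 - (1 - S) * (sin y)^2) / (sin y * cos y) - \<sigma> / 2"
    unfolding secular_def S_def[symmetric] C(1) y_def[symmetric] \<sigma>_def[symmetric] tan_def
    by (simp only: split[OF \<open>sin y > 0\<close> \<open>cos y > 0\<close>])
  also have "S * (cos y)^2 - (1 - S) * (sin y)^2 = S - (sin y)^2"
    unfolding C by (simp add: algebra_simps)
  finally have "secular \<beta> k = 2 * k * (S - (sin y)^2) / (sin y * cos y) - \<sigma> / 2" .
  moreover have "X / (sin y * cos y) - \<sigma> / 2 = 0 \<longleftrightarrow> X = \<sigma> / 2 * (sin y * cos y)" for X
    using p by (auto simp: field_simps)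
  ultimately have "secular \<beta> k = 0 \<longleftrightarrow> 2 * k * (S - (sin y)^2) = \<sigma> / 2 * (sin y * cos y)"
    by presburger
  also have "\<dots> \<longleftrightarrow> S = (sin y)^2 + \<sigma> / (4 * k) * (sin y * cos y)"
    using assms by (simp add: field_simps)
  also have "\<dots> \<longleftrightarrow> 1 - 2 * S = 1 - 2 * (sin y)^2 - \<sigma> / (4 * k) * (2 * (sin y * cos y))"
    by argo
  finally show ?thesis
    unfolding e1 \<sigma>_def .
qed

text \<open>The trigonometric summands are compared only weakly, as their coefficients may vanish;
  strictness comes from the square root.\<close>

lemma secular_strict_antimono:
  assumes "0 < k" "k < l" "l < 1/2"
  shows "secular \<beta> l < secular \<beta> k"
proof -
  have "pi * l * cos (pi * l) / sin (pi * l) \<le> pi * k * cos (pi * k) / sin (pi * k)"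
    using assms by (intro x_cot_x_antimono) auto
  then have "pi * (l * cos (pi * l) / sin (pi * l)) \<le> pi * (k * cos (pi * k) / sin (pi * k))"
    by (simp add: mult.assoc)
  then have "l * cos (pi * l) / sin (pi * l) \<le> k * cos (pi * k) / sin (pi * k)"
    using pi_gt_zero by (simp only: mult_le_cancel_left_pos)
  then have "2 * l * cos (pi * l) / sin (pi * l) \<le> 2 * k * cos (pi * k) / sin (pi * k)"
    by (simp add: mult.assoc)
  then have 1: "(sin (pi * \<beta>))^2 * (2 * l * cos (pi * l) / sin (pi * l)) \<le> (sin (pi * \<beta>))^2 * (2 * k * cos (pi * k) / sin (pi * k))"
    by (intro mult_left_mono) auto
  have "tan (pi * k) \<le> tan (pi * l)"
    using assms by (intro tan_mono_le) (auto intro: less_le_trans[of _ 0])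
  moreover have "tan (pi * k) \<ge> 0"
    using assms by (intro less_imp_le tan_gt_zero) auto
  ultimately have "2 * k * tan (pi * k) \<le> 2 * l * tan (pi * l)"
    using assms by (intro mult_mono) auto
  then have 2: "(cos (pi * \<beta>))^2 * (2 * k * tan (pi * k)) \<le> (cos (pi * \<beta>))^2 * (2 * l * tan (pi * l))"
    by (intro mult_left_mono) auto
  have "k^2 < l^2"
    using assms by (intro power_strict_mono) auto
  then have "sqrt (1 - 4 * l^2) < sqrt (1 - 4 * k^2)"
    by simp
  with 1 2 show ?thesis
    unfolding secular_def by argo
qed

text \<open>Intermediate values: near 0 the function is close to
  \<open>2 * (sin (pi * \<beta>))^2 / pi > 0\<close>, while at \<open>\<beta>\<close> the
  trigonometric summands cancel and a negative term remains.\<close>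

lemma secular_root:
  assumes \<beta>: "0 < \<beta>" "\<beta> \<le> 1/2"
  obtains k where "0 < k" "k < \<beta>" "secular \<beta> k = 0"
proof -
  have sb: "sin (pi * \<beta>) > 0"
    using \<beta> by (intro sin_gt_zero) auto
  \<comment> \<open>The left end of the interval has to be a positive \<open>e\<close>: at 0 itself
    division by zero gives \<open>secular\<close> the spurious value 0.\<close>
  have "filterlim (secular \<beta>) (nhds ((sin (pi * \<beta>))^2 * (2 * inverse pi))) (at_right 0)"
    unfolding secular_def[abs_def] by real_asymp
  moreover have "(sin (pi * \<beta>))^2 * (2 * inverse pi) > 0"
    using sb by simp
  ultimately have "\<forall>\<^sub>F k in at_right 0. secular \<beta> k > 0"
    by (metis order_tendstoD(1))
  moreover have "\<forall>\<^sub>F k in at_right 0. k < \<beta>"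
    using \<beta> eventually_at_right_less by (simp add: eventually_at_right_field) (use \<beta> in blast)
  moreover have "\<forall>\<^sub>F k::real in at_right 0. k > 0"
    by (simp add: eventually_at_right_less)
  ultimately have "\<forall>\<^sub>F k in at_right 0. secular \<beta> k > 0 \<and> k < \<beta> \<and> k > 0"
    by eventually_elim auto
  then obtain e where e: "secular \<beta> e > 0" "e < \<beta>" "e > 0"
    using eventually_happens trivial_limit_at_right_real by blast
  have "sqrt (1 - 4 * \<beta>^2) < sqrt 1"
    using \<beta> by (intro real_sqrt_less_mono) simp
  \<comment> \<open>If the cosine vanishes, then both trigonometric summands are 0, the second one
    by its coefficient.\<close>
  then have end_neg: "secular \<beta> \<beta> < 0"
    using sb by (cases "cos (pi * \<beta>) = 0") (auto simp: secular_def tan_def power2_eq_square)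
  \<comment> \<open>For \<open>\<beta> = 1/2\<close> the tangent blows up at the right end, but its
    coefficient is zero.\<close>
  have tan_cont: "continuous_on {e..\<beta>} (\<lambda>k. (cos (pi * \<beta>))^2 * (2 * k * tan (pi * k)))"
  proof (cases "\<beta> = 1/2")
    case False
    have "cos (pi * k) > 0" if "k \<in> {e..\<beta>}" for k
      using that e \<beta> False by (intro cos_gt_zero) auto
    then have "\<forall>k\<in>{e..\<beta>}. cos (pi * k) \<noteq> 0"
      by force
    then show ?thesis
      by (intro continuous_intros)
  next
    case True
    then have "cos (pi * \<beta>) = 0"
      using cos_pi_half by (simp only: times_divide_eq_right mult_1_right)
    then show ?thesis
      by simp
  qed
  have "sin (pi * k) > 0" if "k \<in> {e..\<beta>}" for k
    using that e \<beta> by (intro sin_gt_zero) auto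
  then have "\<forall>k\<in>{e..\<beta>}. sin (pi * k) \<noteq> 0"
    by force
  then have "continuous_on {e..\<beta>} (secular \<beta>)"
    unfolding secular_def[abs_def] by (intro continuous_on_diff tan_cont) (auto intro!: continuous_intros)
  then obtain k where "e \<le> k" "k \<le> \<beta>" "secular \<beta> k = 0"
    using IVT2'[of "secular \<beta>" \<beta> 0 e] e end_neg by auto
  then show ?thesis
    using that[of k] e end_neg by (cases "k = \<beta>") auto
qed

text \<open>Resolves the definite description: every candidate is the square of some
  \<open>l\<close> in \<open>(0, \<beta>)\<close>, so \<open>secular_root\<close> gives existence
  and \<open>secular_strict_antimono\<close> uniqueness.\<close>

lemma lambda_star_base_eq:
  assumes \<beta>: "0 < \<beta>" "\<beta> \<le> 1/2"
  obtains k where "0 < k" "k < 1/2" "lambda_star_base \<beta> = k^2"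
    "cos (2*pi*\<beta>) = cos (2 * pi * k) - (1 - sqrt (1 - 4*k^2)) / (4 * k) * sin (2 * pi * k)"
proof -
  obtain k where k: "0 < k" "k < \<beta>" "secular \<beta> k = 0"
    using secular_root[OF \<beta>] .
  have eqk: "cos (2*pi*\<beta>) = cos (2 * pi * k) - (1 - sqrt (1 - 4*k^2)) / (4 * k) * sin (2 * pi * k)"
    using secular_eq_0_iff[of k \<beta>] k \<beta> by simp
  have "lambda_star_base \<beta> = k^2"
    unfolding lambda_star_base_def
  proof (rule the_equality)
    show "0 < k^2 \<and> k^2 < \<beta>^2 \<and> cos (2*pi*\<beta>) = cos (2 * pi * sqrt (k^2)) -
        (1 - sqrt (1 - 4 * k^2)) / (4 * sqrt (k^2)) * sin (2 * pi * sqrt (k^2))"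
      using k eqk by (auto intro!: power_strict_mono)
    fix lam
    assume lam: "0 < lam \<and> lam < \<beta>^2 \<and> cos (2*pi*\<beta>) = cos (2 * pi * sqrt lam) -
        (1 - sqrt (1 - 4 * lam)) / (4 * sqrt lam) * sin (2 * pi * sqrt lam)"
    define l where "l = sqrt lam"
    have l: "l > 0" "lam = l^2" "l < \<beta>"
      using lam \<beta> by (auto simp: l_def intro: real_less_lsqrt)
    then have "secular \<beta> l = 0"
      using secular_eq_0_iff[of l \<beta>] \<beta> lam by simp
    then have "l = k"
      using secular_strict_antimono[of k l \<beta>] secular_strict_antimono[of l k \<beta>] k l \<beta>
      by (cases l k rule: linorder_cases) auto
    then show "lam = k^2" using l by simp
  qed
  then show ?thesis
    using that[of k] k \<beta> eqk by simp
qed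

text \<open>The equation sees \<open>\<alpha>\<close> only through
  \<open>cos (2 * pi * \<alpha>)\<close>, which is even and 1-periodic, so it also holds for
  \<open>\<alpha>\<close> itself in place of its distance to the nearest integer.\<close>

lemma lambda_star_eq:
  assumes "\<alpha> \<notin> \<int>"
  obtains k where "0 < k" "k < 1/2" "lambda_star \<alpha> = k^2"
    "cos (2*pi*\<alpha>) = cos (2 * pi * k) - (1 - sqrt (1 - 4*k^2)) / (4 * k) * sin (2 * pi * k)"
proof -
  define \<beta> where "\<beta> = \<bar>\<alpha> - of_int (round \<alpha>)\<bar>"
  have "\<beta> \<noteq> 0"
    using assms Ints_of_int[of "round \<alpha>"] unfolding \<beta>_def by (metis abs_eq_0 eq_iff_diff_eq_0)
  then have \<beta>: "0 < \<beta>" "\<beta> \<le> 1/2"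
    using of_int_round_abs_le[of \<alpha>] by (auto simp: \<beta>_def abs_minus_commute)
  have "cos (2*pi*\<beta>) = cos (2*pi*(\<alpha> - of_int (round \<alpha>)))"
    unfolding \<beta>_def by (metis abs_mult abs_of_pos cos_abs_real pi_gt_zero mult_pos_pos zero_less_numeral)
  also have "\<dots> = cos (2*pi*\<alpha>)"
    unfolding right_diff_distrib cos_diff by (simp only: cos_int_2pin sin_int_2pin mult_1_right mult_zero_right add_0_right)
  finally have "cos (2*pi*\<beta>) = cos (2*pi*\<alpha>)" .
  moreover have "lambda_star \<alpha> = lambda_star_base \<beta>"
    using \<open>\<beta> \<noteq> 0\<close> by (simp add: lambda_star_def Let_def flip: \<beta>_def)
  ultimately show ?thesis
    using lambda_star_base_eq[OF \<beta>] that by (smt (verit))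
qed

section \<open>The Hardy inequality\<close>

text \<open>Here \<open>e\<close> is the exponential of \<open>\<i>\<close> times the primitive of
  \<open>a\<close>, the conjugate of the gauge factor. As \<open>a\<close> is merely
  square-integrable, its derivative comes from \<open>AC_on_chain\<close>.\<close>

lemma gauge_factor_AC_on:
  assumes "L2_on {0..2*pi} a"
  obtains e :: "real \<Rightarrow> complex" where "AC_on 0 (2 * pi) e (\<lambda>t. e t * (\<i> * of_real (a t)))" "e 0 = 1"
    "e (2 * pi) = cis (integral {0..2*pi} a)" "\<And>t. cmod (e t) = 1"
proof -
  define A where "A t = integral {0..t} a" for t
  have aa: "a absolutely_integrable_on {0..2 * pi}"
    by (rule L2_on_absolutely_integrable[OF assms])
  have "(\<lambda>t. complex_of_real (a t)) absolutely_integrable_on {0..2 * pi}"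
    using absolutely_integrable_linear[OF aa bounded_linear_of_real] by (simp add: o_def)
  moreover have "((\<lambda>t. complex_of_real (a t)) has_integral (of_real (A x) - of_real (A 0))) {0..x}"
    if "x \<in> {0..2 * pi}" for x
  proof -
    have "a integrable_on {0..x}"
      using aa that by (auto simp: absolutely_integrable_on_def intro: integrable_subinterval_real)
    from has_integral_linear[OF integrable_integral[OF this] bounded_linear_of_real]
    show ?thesis by (simp add: A_def o_def)
  qed
  ultimately have "AC_on 0 (2 * pi) (\<lambda>t. of_real (A t)) (\<lambda>t. of_real (a t))"
    by (simp add: AC_on_def)
  from AC_on_chain[OF AC_on_cmult[OF this, of \<i>], where H = exp and H' = exp]
  have "AC_on 0 (2 * pi) (\<lambda>t. cis (A t)) (\<lambda>t. cis (A t) * (\<i> * of_real (a t)))"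
    by (simp add: DERIV_exp continuous_on_exp cis_conv_exp)
  then show ?thesis
    by (rule that) (auto simp: A_def)
qed

text \<open>\<open>s\<close> is the smaller root of \<open>s - s^2 = k^2\<close>, hence the smaller
  exponent for which \<open>r powr s\<close> solves the half-line equation.\<close>

lemma exponent_identity:
  fixes k s :: real
  assumes "0 < k" "k < 1/2" "s = (1 - sqrt (1 - 4 * k^2)) / 2"
  shows "s - s^2 = k^2" "0 \<le> s" "s < 1/2"
proof -
  have "k^2 < (1/2)^2"
    using assms by (intro power_strict_mono) auto
  then have 1: "1 - 4 * k^2 > 0" by (simp add: power2_eq_square)
  then have "(sqrt (1 - 4 * k^2))^2 = 1 - 4 * k^2"
    by simp
  then show "s - s^2 = k^2"
    unfolding assms(3) power_divide power2_diff by (simp add: field_simps)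
  show "s < 1/2"
    using 1 unfolding assms(3) by simp
  have "sqrt (1 - 4 * k^2) \<le> sqrt 1"
    by (intro real_sqrt_le_mono) simp
  then show "0 \<le> s"
    unfolding assms(3) by simp
qed

theorem theorem4p2:
  fixes a :: "real \<Rightarrow> real" and \<alpha> :: real
  assumes "L2_on {0..2*pi} a"
    and "\<alpha> = (1 / (2*pi)) * integral {0..2*pi} a"
    and "\<alpha> \<notin> \<int>"
  shows "(\<forall>u1 g1 u2 g2. H1_Gamma u1 g1 u2 g2 \<longrightarrow>
            h_form a u1 g1 u2 g2 \<ge> lambda_star \<alpha> * psi_norm u1 u2)
       \<and> (\<forall>lam. lam > lambda_star \<alpha> \<longrightarrow>
            (\<exists>u1 g1 u2 g2. H1_Gamma u1 g1 u2 g2 \<and> h_form a u1 g1 u2 g2 < lam * psi_norm u1 u2))"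
proof -
  obtain k where k: "0 < k" "k < 1/2" "lambda_star \<alpha> = k^2"
    and eqk: "cos (2*pi*\<alpha>) = cos (2 * pi * k) - (1 - sqrt (1 - 4*k^2)) / (4 * k) * sin (2 * pi * k)"
    using lambda_star_eq[OF assms(3)] .
  define s where "s = (1 - sqrt (1 - 4 * k^2)) / 2"
  note s = exponent_identity[OF k(1,2) s_def]
  have sk: "sin (2 * pi * k) > 0"
    using k by (intro sin_gt_zero) auto
  have "cos (2 * pi * k) - cos (2 * pi * \<alpha>) = s / (2 * k) * sin (2 * pi * k)"
    unfolding eqk s_def by simp
  \<comment> \<open>The defining equation of \<open>lambda_star\<close> in energy terms: for
    junction value 1 the circle contributes at least \<open>s\<close>, exactly what the half-line
    can lose.\<close>
  then have matching: "k / sin (2 * pi * k) * (2 * (cos (2 * pi * k) - cos (2 * pi * \<alpha>))) = s"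
    using sk k by simp
  have int_a: "integral {0..2*pi} a = 2 * pi * \<alpha>"
    using assms(2) by simp
  obtain e where e: "AC_on 0 (2 * pi) e (\<lambda>t. e t * (\<i> * of_real (a t)))" "e 0 = 1"
    "e (2 * pi) = cis (2 * pi * \<alpha>)" and norm_e: "\<And>t. cmod (e t) = 1"
    using gauge_factor_AC_on[OF assms(1)] unfolding int_a by blast
  have ce: "continuous_on {0..2 * pi} e"
    by (rule AC_on_continuous[OF e(1)])
  have a2: "L2_on {0..2 * pi} (\<lambda>t. complex_of_real (a t))"
    by (rule L2_on_of_real[OF assms(1)])
  have lower: "h_form a u1 g1 u2 g2 \<ge> lambda_star \<alpha> * psi_norm u1 u2" if H: "H1_Gamma u1 g1 u2 g2" for u1 g1 u2 g2
  proof -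
    have H1: "H1_interval 0 (2 * pi) u1 g1" and H2: "H1_halfline 1 u2 g2"
      and ends: "u1 0 = u1 (2 * pi)" "u1 0 = u2 1"
      using H by (auto simp: H1_Gamma_def)
    have AC: "AC_on 0 (2 * pi) u1 g1"
      by (rule H1_interval_AC_on[OF H1]) simp
    \<comment> \<open>Gauge transformation: \<open>v\<close> has the modulus of \<open>u1\<close>,
      and its derivative \<open>g\<close> has the modulus of the magnetic derivative of
      \<open>u1\<close>.\<close>
    define v where "v t = u1 t * cnj (e t)" for t
    define g where "g t = cnj (e t) * (g1 t + - \<i> * u1 t * of_real (a t))" for t
    have "AC_on 0 (2 * pi) v (\<lambda>t. g1 t * cnj (e t) + u1 t * cnj (e t * (\<i> * of_real (a t))))"
      unfolding v_def by (intro AC_on_mult AC AC_on_cnj e)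
    then have v: "AC_on 0 (2 * pi) v g"
      by (rule AC_on_cong) (auto simp: g_def algebra_simps)
    have "L2_on {0..2 * pi} g"
      unfolding g_def[abs_def]
      by (intro L2_on_continuous_mult L2_on_add continuous_intros ce AC_on_continuous[OF AC] a2)
         (use H1 in \<open>auto simp: H1_interval_def\<close>)
    then have gi: "(\<lambda>t. (cmod (g t))^2) integrable_on {0..2 * pi}"
      by (simp add: L2_on_def)
    have cmod_g: "cmod (- \<i> * g1 t - complex_of_real (a t) * u1 t) = cmod (g t)" for t
    proof -
      have "- \<i> * g1 t - complex_of_real (a t) * u1 t = - \<i> * (g1 t + - \<i> * u1 t * of_real (a t))"
        by (simp add: algebra_simps)
      then show ?thesis
        by (simp only: g_def norm_mult norm_minus_cancel norm_ii complex_mod_cnj norm_e)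
    qed
    have cmod_v: "cmod (v t) = cmod (u1 t)" for t
      by (simp add: v_def norm_mult norm_e)
    \<comment> \<open>Quasi-periodicity of \<open>v\<close>: the phase between its end values brings
      \<open>cos (2 * pi * \<alpha>)\<close> into the circle bound.\<close>
    have "v 0 = u1 0" "v (2 * pi) = u1 0 * cis (- (2 * pi * \<alpha>))"
      using e ends by (simp_all add: v_def cis_cnj)
    then have "v 0 * cnj (v (2 * pi)) = of_real ((cmod (u1 0))^2) * cis (2 * pi * \<alpha>)"
      by (simp add: complex_norm_square cis_cnj del: of_real_power)
    then have Re_v: "Re (v 0 * cnj (v (2 * pi))) = (cmod (u1 0))^2 * cos (2 * pi * \<alpha>)"
      by (simp del: of_real_power)
    have "s * (cmod (u1 0))^2 = k / sin (2 * pi * k) * (2 * (cos (2 * pi * k) - cos (2 * pi * \<alpha>))) * (cmod (u1 0))^2"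
      unfolding matching ..
    also have "\<dots> = k / sin (2 * pi * k) * (((cmod (v 0))^2 + (cmod (v (2 * pi)))^2) * cos (2 * pi * k)
        - 2 * Re (v 0 * cnj (v (2 * pi))))"
      unfolding Re_v cmod_v ends(1)[symmetric] by (simp add: algebra_simps)
    also have "\<dots> \<le> integral {0..2 * pi} (\<lambda>t. (cmod (g t))^2) - k^2 * integral {0..2 * pi} (\<lambda>t. (cmod (v t))^2)"
      by (rule circle_lower_bound[OF v gi k(1,2)])
    finally have circle: "s * (cmod (u1 0))^2 \<le> \<dots>" .
    have "- s * (cmod (u2 1))^2 \<le> integral {1..} (\<lambda>r. (cmod (g2 r))^2) - k^2 * integral {1..} (\<lambda>r. (cmod (u2 r))^2 / r^2)"
      using halfline_lower_bound[OF H2 s(2)] unfolding s(1) .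
    with circle show ?thesis
      unfolding h_form_def psi_norm_def k(3) cmod_g cmod_v ends(2) by (simp add: algebra_simps)
  qed
  have sharp: "\<exists>u1 g1 u2 g2. H1_Gamma u1 g1 u2 g2 \<and> h_form a u1 g1 u2 g2 < lam * psi_norm u1 u2"
    if lam: "lam > lambda_star \<alpha>" for lam
  proof -
    \<comment> \<open>The end value that cancels \<open>e (2 * pi)\<close>, so that
      \<open>w t * e t\<close> closes up to a continuous function on the circle.\<close>
    define z where "z = cis (- (2 * pi * \<alpha>))"
    define w where "w = sine_interp k 1 z"
    define w' where "w' = sine_interp' k 1 z"
    note cw = continuous_on_sine_interp[of k 1 z, folded w_def w'_def]
    have w_ends: "w 0 = 1" "w (2 * pi) = z"
      using sine_interp_ends[of k 1 z] sk by (simp_all add: w_def)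
    define I where "I = integral {0..2 * pi} (\<lambda>t. (cmod (w t))^2)"
    have wi: "(\<lambda>t. (cmod (w t))^2) integrable_on {0..2 * pi}"
      by (intro integrable_continuous_interval continuous_intros cw)
    \<comment> \<open>Positivity of the circle norm makes the gain from \<open>lam > k^2\<close>
      strict.\<close>
    have I0: "I > 0"
    proof -
      have "I \<ge> 0"
        unfolding I_def by (intro Henstock_Kurzweil_Integration.integral_nonneg wi) auto
      moreover have "I \<noteq> 0"
      proof
        assume "I = 0"
        then have "((\<lambda>t. (cmod (w t))^2) has_integral 0) (cbox 0 (2 * pi))"
          using wi by (simp add: I_def has_integral_iff)
        then have "(cmod (w 0))^2 = 0"
          by (rule has_integral_0_cbox_imp_0[rotated 2])
             (auto intro!: continuous_intros cw, use pi_gt_zero in linarith)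
        then show False
          using w_ends by simp
      qed
      ultimately show ?thesis by simp
    qed
    have energy: "integral {0..2 * pi} (\<lambda>t. (cmod (w' t))^2) - k^2 * I = s"
    proof -
      have "((cmod 1)^2 + (cmod z)^2) * cos (2 * pi * k) - 2 * Re (1 * cnj z)
          = 2 * (cos (2 * pi * k) - cos (2 * pi * \<alpha>))"
        by (simp add: z_def)
      then show ?thesis
        using sine_interp_energy[of k 1 z] sk matching unfolding I_def w_def w'_def by (simp only: less_imp_neq[symmetric] not_False_eq_True True_implies_equals)
    qed
    \<comment> \<open>Half of the gain \<open>(lam - k^2) * I\<close> on the circle; the half-line
      trial function may lose this much. The half-line norm \<open>J \<ge> 0\<close> only increases
      the gain.\<close>
    define \<epsilon> where "\<epsilon> = (lam - k^2) * I / 2"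
    have \<epsilon>: "0 < \<epsilon>" "\<epsilon> < (lam - k^2) * I"
      using lam I0 k(3) by (simp_all add: \<epsilon>_def)
    obtain u2 g2 where u2: "H1_halfline 1 u2 g2" "u2 1 = 1"
      and energy2: "integral {1..} (\<lambda>r. (cmod (g2 r))^2) - k^2 * integral {1..} (\<lambda>r. (cmod (u2 r))^2 / r^2) \<le> - s + \<epsilon>"
      using halfline_trial[OF s(2,3) \<epsilon>(1)] unfolding s(1) by blast
    define u1 where "u1 t = w t * e t" for t
    define g1 where "g1 t = w' t * e t + w t * (e t * (\<i> * of_real (a t)))" for t
    have u1: "AC_on 0 (2 * pi) u1 g1"
      unfolding u1_def g1_def w_def w'_def by (intro AC_on_mult AC_on_sine_interp e)
    have "L2_on {0..2 * pi} u1"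
      unfolding u1_def[abs_def] by (intro L2_on_continuous continuous_intros cw ce)
    moreover have "L2_on {0..2 * pi} g1"
      unfolding g1_def[abs_def]
      by (intro L2_on_add L2_on_continuous_mult[OF cw(1)] L2_on_continuous_mult[OF ce] 
          L2_on_continuous_mult[OF continuous_on_const] L2_on_continuous[OF continuous_on_mult[OF cw(2) ce]] a2) auto
    ultimately have "H1_interval 0 (2 * pi) u1 g1"
      using u1 by (simp add: H1_interval_def AC_on_def)
    moreover have "u1 0 = 1" "u1 (2 * pi) = 1"
      using w_ends e by (simp_all add: u1_def z_def cis_mult)
    ultimately have H: "H1_Gamma u1 g1 u2 g2"
      using u2 by (simp add: H1_Gamma_def)
    have cmod_g1: "cmod (- \<i> * g1 t - complex_of_real (a t) * u1 t) = cmod (w' t)" for t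
    proof -
      have "- \<i> * g1 t - complex_of_real (a t) * u1 t = - \<i> * (w' t * e t)"
        by (simp add: g1_def u1_def algebra_simps)
      then show ?thesis
        by (simp only: norm_mult norm_minus_cancel norm_ii norm_e mult_1_left mult_1_right)
    qed
    have cmod_u1: "cmod (u1 t) = cmod (w t)" for t
      by (simp add: u1_def norm_mult norm_e)
    define J where "J = integral {1..} (\<lambda>r. (cmod (u2 r))^2 / r^2)"
    have "J \<ge> 0"
      unfolding J_def using u2
      by (intro Henstock_Kurzweil_Integration.integral_nonneg L2_on_weighted_integrable) (auto simp: H1_halfline_def)
    have "h_form a u1 g1 u2 g2 \<le> k^2 * (I + J) + \<epsilon>"
      unfolding h_form_def cmod_g1 using energy energy2 by (simp add: J_def algebra_simps)
    also have "\<dots> < k^2 * (I + J) + (lam - k^2) * (I + J)"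
      using \<epsilon>(2) mult_nonneg_nonneg[of "lam - k^2" J] \<open>J \<ge> 0\<close> lam k(3) unfolding distrib_left by linarith
    also have "\<dots> = lam * psi_norm u1 u2"
      unfolding psi_norm_def cmod_u1 I_def[symmetric] J_def[symmetric] by (simp add: algebra_simps)
    finally show ?thesis
      using H by blast
  qed
  show ?thesis
    using lower sharp by blast
qed

end
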